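(* Let $h=(h_1,\ldots,h_{m_1})$ and $g=(g_1,\ldots,g_{m_2})$ be tuples of polynomials in $\mathbb{R}[x]=\mathbb{R}[x_1,\ldots,x_n]$, and let $K=\{x\in\mathbb{R}^n: h(x)=0,\ g(x)\ge 0\}\neq\emptyset$. Suppose $I(h)+Q(g)$ is archimedean, $\mathcal{A}\subseteq\mathbb{N}^n$ is finite and $\mathbb{R}[x]_{\mathcal{A}}$ is $K$-full. Then $$\mathscr{R}_{\mathcal{A}}(K)=\bigcap_{k=1}^{\infty}\mathscr{S}_{\mathcal{A}}^k(K).$$
   Context: $\mathbb{N}$ is the set of nonnegative integers, $\mathbb{N}^n_d=\{\alpha\in\mathbb{N}^n:|\alpha|\le d\}$ with $|\alpha|=\alpha_1+\cdots+\alpha_n$, and $\mathbb{R}[x]_d$ is the space of polynomials of degree at most $d$. For finite $\mathcal{A}\subseteq\mathbb{N}^n$: $\mathbb{R}[x]_{\mathcal{A}}=\mathrm{span}\{x^\alpha:\alpha\in\mathcal{A}\}$; $\mathbb{R}^{\mathcal{A}}$ is the space of real vectors $(y_\alpha)_{\alpha\in\mathcal{A}}$; $\deg(\mathcal{A})=\max\{|\alpha|:\alpha\in\mathcal{A}\}$. $\mathbb{R}[x]_{\mathcal{A}}$ is $K$-full if some $p\in\mathbb{R}[x]_{\mathcal{A}}$ is positive on $K$. For a vector $z\in\mathbb{R}^{\mathbb{N}^n_{2k}}$, $z|_{\mathcal{A}}$ is its subvector indexed by $\mathcal{A}$, and $\mathscr{L}_z(\sum_\alpha p_\alpha x^\alpha)=\sum_\alpha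 p_\alpha z_\alpha$ for polynomials of degree at most $2k$. $\mathscr{R}_{\mathcal{A}}(K)$ is the set of $y\in\mathbb{R}^{\mathcal{A}}$ for which there is a (nonnegative) Borel measure $\mu$ supported in $K$ with $y_\alpha=\int x^\alpha d\mu$ for all $\alpha\in\mathcal{A}$. $I(h)=h_1\mathbb{R}[x]+\cdots+h_{m_1}\mathbb{R}[x]$ is the ideal generated by $h$, and $Q(g)=\{\sigma_0+\sigma_1g_1+\cdots+\sigma_{m_2}g_{m_2}:\ \sigma_j \text{ sums of squares in }\mathbb{R}[x]\}$ is the quadratic module generated by $g$. $I(h)+Q(g)$ is archimedean if $R-\|x\|_2^2\in I(h)+Q(g)$ for some $R>0$. For a polynomial $q$ and $z\in\mathbb{R}^{\mathbb{N}^n_{2k}}$, the localizing matrix $L_q^{(k)}(z)$ is the symmetric matrix with $\mathscr{L}_z(qp^2)=p^T L_q^{(k)}(z)\,p$ for all $p\in\mathbb{R}[x]$ with $\deg(qp^2)\le 2k$ (here $p$ also denotes its coefficient vector). With $g_0=1$, let $\Phi_k(g)=\{w\in\mathbb{R}^{\mathbb{N}^n_{2k}}: L_{g_j}^{(k)}(w)\succeq 0,\ j=0,1,\ldots,m_2\}$ and $E_k(h)=\{w\in\mathbb{R}^{\mathbb{N}^n_{2k}}: L_{h_i}^{(k)}(w)=0,\ i=1,\ldots,m_1\}$. Finally $\mathscr{S}_{\mathcal{A}}^k(K)=\{z|_{\mathcal{A}}: z\in\Phi_k(g)\cap E_k(h)\}$ if $k\ge\deg(\mathcal{A})/2$, and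 $\mathscr{S}_{\mathcal{A}}^k(K)=\mathbb{R}^{\mathcal{A}}$ if $k<\deg(\mathcal{A})/2$. *)

theory Defs
  imports
    "HOL-Analysis.Analysis"
    "HOL-Analysis.Finite_Function_Topology"
    "HOL-Library.Poly_Mapping"
begin

text \<open>
  Exponents in \<open>\<nat>\<^sup>n\<close> are finitely supported maps from a finite index type \<open>'n\<close> with
  \<open>n = CARD('n)\<close>; real polynomials in \<open>x\<^sub>1, \<dots>, x\<^sub>n\<close> are finitely supported maps from exponents
  to coefficients, with the convolution product of the library.
\<close>

type_synonym 'n expo = "'n \<Rightarrow>\<^sub>0 nat"
type_synonym 'n rpoly = "'n expo \<Rightarrow>\<^sub>0 real"

definition expo_deg :: "'n::finite expo \<Rightarrow> nat" where
  "expo_deg \<alpha> = (\<Sum>i\<in>UNIV. Poly_Mapping.lookup \<alpha> i)"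

definition expos_upto :: "nat \<Rightarrow> 'n::finite expo set" where
  "expos_upto d = {\<alpha>. expo_deg \<alpha> \<le> d}"

definition xpow :: "'n expo \<Rightarrow> 'n rpoly" where
  "xpow \<alpha> = Poly_Mapping.single \<alpha> 1"

definition const_poly :: "real \<Rightarrow> 'n rpoly" where
  "const_poly c = Poly_Mapping.single 0 c"

definition var :: "'n \<Rightarrow> 'n rpoly" where
  "var i = xpow (Poly_Mapping.single i 1)"

text \<open>The zero polynomial gets degree 0.\<close>

definition poly_deg :: "'n::finite rpoly \<Rightarrow> nat" where
  "poly_deg p = Max (insert 0 (expo_deg ` Poly_Mapping.keys p))"

definition expo_eval :: "'n::finite expo \<Rightarrow> real ^ 'n \<Rightarrow> real" where
  "expo_eval \<alpha> x = (\<Prod>i\<in>UNIV. (x $ i) ^ Poly_Mapping.lookup \<alpha> i)"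

definition poly_eval :: "'n::finite rpoly \<Rightarrow> real ^ 'n \<Rightarrow> real" where
  "poly_eval p x = (\<Sum>\<alpha>\<in>Poly_Mapping.keys p. Poly_Mapping.lookup p \<alpha> * expo_eval \<alpha> x)"

definition feasible_set :: "'n::finite rpoly list \<Rightarrow> 'n rpoly list \<Rightarrow> (real ^ 'n) set" where
  "feasible_set h g =
     {x. (\<forall>i<length h. poly_eval (h ! i) x = 0) \<and> (\<forall>j<length g. poly_eval (g ! j) x \<ge> 0)}"

definition polys_on :: "'n expo set \<Rightarrow> 'n rpoly set" where
  "polys_on A = span (xpow ` A)"

definition expos_deg :: "'n::finite expo set \<Rightarrow> nat" where
  "expos_deg A = Max (expo_deg ` A)"

definition full_on :: "(real ^ 'n) set \<Rightarrow> 'n::finite expo set \<Rightarrow> bool" where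
  "full_on K A \<longleftrightarrow> (\<exists>p\<in>polys_on A. \<forall>x\<in>K. poly_eval p x > 0)"

definition poly_ideal :: "'n rpoly list \<Rightarrow> 'n rpoly set" where
  "poly_ideal h = {\<Sum>i<length h. h ! i * f i | f. True}"

definition sos :: "'n rpoly set" where
  "sos = {\<Sum>i<m. (f i)\<^sup>2 | (m::nat) f. True}"

definition quadratic_module :: "'n rpoly list \<Rightarrow> 'n rpoly set" where
  "quadratic_module g =
     {\<sigma>\<^sub>0 + (\<Sum>j<length g. \<sigma> j * g ! j) | \<sigma>\<^sub>0 \<sigma>. \<sigma>\<^sub>0 \<in> sos \<and> (\<forall>j<length g. \<sigma> j \<in> sos)}"

definition ideal_plus_qmodule :: "'n rpoly list \<Rightarrow> 'n rpoly list \<Rightarrow> 'n rpoly set" where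
  "ideal_plus_qmodule h g = {a + b | a b. a \<in> poly_ideal h \<and> b \<in> quadratic_module g}"

definition archimedean_polys :: "'n::finite rpoly set \<Rightarrow> bool" where
  "archimedean_polys M \<longleftrightarrow> (\<exists>R>0. const_poly R - (\<Sum>i\<in>UNIV. (var i)\<^sup>2) \<in> M)"

text \<open>
  The space \<open>\<real>\<^sup>A\<close> of vectors indexed by \<open>A\<close> is \<^term>\<open>extensional A\<close>: functions with a fixed
  dummy value outside \<open>A\<close>, so that equality of such functions is equality on \<open>A\<close>.

  The measure below is not assumed finite, so integrability of the monomials is required
  explicitly (the Bochner integral of a non-integrable function is 0).
\<close>

definition moment_set :: "'n::finite expo set \<Rightarrow> (real ^ 'n) set \<Rightarrow> ('n expo \<Rightarrow> real) set" where
  "moment_set A K =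
     {y \<in> extensional A. \<exists>\<mu> :: (real ^ 'n) measure.
        sets \<mu> = sets borel \<and> - K \<in> null_sets \<mu> \<and>
        (\<forall>\<alpha>\<in>A. integrable \<mu> (expo_eval \<alpha>) \<and> y \<alpha> = integral\<^sup>L \<mu> (expo_eval \<alpha>))}"

definition riesz :: "('n expo \<Rightarrow> real) \<Rightarrow> 'n rpoly \<Rightarrow> real" where
  "riesz z p = (\<Sum>\<alpha>\<in>Poly_Mapping.keys p. Poly_Mapping.lookup p \<alpha> * z \<alpha>)"

text \<open>
  Rows and columns of \<open>L\<^sub>q\<^sup>(\<^sup>k\<^sup>)(z)\<close> are indexed by the exponents of the polynomials \<open>p\<close> with
  \<open>deg (q p\<^sup>2) \<le> 2k\<close>, so there are none if \<open>deg q > 2k\<close>. Matrices are functions vanishing outside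
  the index set. Existence, uniqueness and the entries of the localizing matrix are
  established in \<open>ex1_localizing_matrix\<close> and \<open>localizing_matrix_entry\<close> below.
\<close>

definition loc_index :: "nat \<Rightarrow> 'n::finite rpoly \<Rightarrow> 'n expo set" where
  "loc_index k q = {\<beta>. poly_deg q + 2 * expo_deg \<beta> \<le> 2 * k}"

definition is_localizing_matrix ::
    "nat \<Rightarrow> 'n::finite rpoly \<Rightarrow> ('n expo \<Rightarrow> real) \<Rightarrow> ('n expo \<Rightarrow> 'n expo \<Rightarrow> real) \<Rightarrow> bool" where
  "is_localizing_matrix k q z M \<longleftrightarrow>
     (\<forall>\<beta> \<gamma>. M \<beta> \<gamma> \<noteq> 0 \<longrightarrow> \<beta> \<in> loc_index k q \<and> \<gamma> \<in> loc_index k q) \<and>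
     (\<forall>\<beta> \<gamma>. M \<beta> \<gamma> = M \<gamma> \<beta>) \<and>
     (\<forall>p. poly_deg (q * p\<^sup>2) \<le> 2 * k \<longrightarrow>
        riesz z (q * p\<^sup>2) =
          (\<Sum>\<beta>\<in>loc_index k q. \<Sum>\<gamma>\<in>loc_index k q.
             Poly_Mapping.lookup p \<beta> * M \<beta> \<gamma> * Poly_Mapping.lookup p \<gamma>))"

definition localizing_matrix ::
    "nat \<Rightarrow> 'n::finite rpoly \<Rightarrow> ('n expo \<Rightarrow> real) \<Rightarrow> 'n expo \<Rightarrow> 'n expo \<Rightarrow> real" where
  "localizing_matrix k q z = (THE M. is_localizing_matrix k q z M)"

definition psd_on :: "'i set \<Rightarrow> ('i \<Rightarrow> 'i \<Rightarrow> real) \<Rightarrow> bool" where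
  "psd_on I M \<longleftrightarrow>
     (\<forall>i\<in>I. \<forall>j\<in>I. M i j = M j i) \<and>
     (\<forall>v. (\<Sum>i\<in>I. \<Sum>j\<in>I. v i * M i j * v j) \<ge> 0)"

definition Phi_set :: "nat \<Rightarrow> 'n::finite rpoly list \<Rightarrow> ('n expo \<Rightarrow> real) set" where
  "Phi_set k g =
     {w \<in> extensional (expos_upto (2 * k)).
        \<forall>q \<in> insert 1 (set g). psd_on (loc_index k q) (localizing_matrix k q w)}"

definition E_set :: "nat \<Rightarrow> 'n::finite rpoly list \<Rightarrow> ('n expo \<Rightarrow> real) set" where
  "E_set k h =
     {w \<in> extensional (expos_upto (2 * k)).
        \<forall>q \<in> set h. \<forall>\<beta>\<in>loc_index k q. \<forall>\<gamma>\<in>loc_index k q. localizing_matrix k q w \<beta> \<gamma> = 0}"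

definition moment_relaxation ::
    "'n::finite expo set \<Rightarrow> 'n rpoly list \<Rightarrow> 'n rpoly list \<Rightarrow> nat \<Rightarrow> ('n expo \<Rightarrow> real) set" where
  "moment_relaxation A h g k =
     (if real k \<ge> real (expos_deg A) / 2
      then (\<lambda>z. restrict z A) ` (Phi_set k g \<inter> E_set k h)
      else extensional A)"


subsection \<open>Degrees of products\<close>

lemma expo_deg_add: "expo_deg (a + b) = expo_deg a + expo_deg b"
  by (simp add: expo_deg_def lookup_add sum.distrib)

lemma expo_deg_le_poly_deg: "a \<in> Poly_Mapping.keys p \<Longrightarrow> expo_deg a \<le> poly_deg p"
  by (simp add: poly_deg_def)

lemma poly_deg_attained:
  assumes "p \<noteq> 0"
  obtains a where "a \<in> Poly_Mapping.keys p" "expo_deg a = poly_deg p"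
proof -
  have ne: "Poly_Mapping.keys p \<noteq> {}" using assms by simp
  have "poly_deg p \<in> expo_deg ` Poly_Mapping.keys p"
  proof -
    have "poly_deg p = max 0 (Max (expo_deg ` Poly_Mapping.keys p))"
      unfolding poly_deg_def by (subst Max_insert) (use ne in auto)
    then show ?thesis using Max_in[of "expo_deg ` Poly_Mapping.keys p"] ne by simp
  qed
  then show ?thesis using that by auto
qed

lemma poly_expand:
  fixes p :: "'a \<Rightarrow>\<^sub>0 'b::comm_monoid_add"
  assumes "finite I" "Poly_Mapping.keys p \<subseteq> I"
  shows "p = (\<Sum>a\<in>I. Poly_Mapping.single a (Poly_Mapping.lookup p a))"
proof (rule poly_mapping_eqI)
  fix k
  have "(\<Sum>a\<in>I. Poly_Mapping.lookup (Poly_Mapping.single a (Poly_Mapping.lookup p a)) k)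
      = (\<Sum>a\<in>I. if a = k then Poly_Mapping.lookup p k else 0)"
    by (rule sum.cong) (auto simp: lookup_single when_def)
  also have "\<dots> = Poly_Mapping.lookup p k"
    using assms by (auto simp: sum.delta in_keys_iff)
  finally show "Poly_Mapping.lookup p k =
      Poly_Mapping.lookup (\<Sum>a\<in>I. Poly_Mapping.single a (Poly_Mapping.lookup p a)) k"
    by (simp add: lookup_sum)
qed

definition nat_expo :: "'n::finite expo \<Rightarrow> nat \<Rightarrow>\<^sub>0 nat" where
  "nat_expo \<alpha> = (\<Sum>i\<in>UNIV. Poly_Mapping.single (to_nat i) (Poly_Mapping.lookup \<alpha> i))"

lemma nat_expo_add: "nat_expo (a + b) = nat_expo a + nat_expo b"
  by (simp add: nat_expo_def lookup_add single_add sum.distrib)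

lemma lookup_nat_expo: "Poly_Mapping.lookup (nat_expo a) (to_nat i) = Poly_Mapping.lookup a i"
proof -
  have "Poly_Mapping.lookup (nat_expo a) (to_nat i)
      = (\<Sum>j\<in>UNIV. if j = i then Poly_Mapping.lookup a i else 0)"
    unfolding nat_expo_def lookup_sum
    by (rule sum.cong) (auto simp: lookup_single when_def)
  then show ?thesis by simp
qed

lemma inj_nat_expo: "nat_expo a = nat_expo b \<Longrightarrow> a = b"
  by (metis lookup_nat_expo poly_mapping_eqI)

lemma poly_deg_leading:
  fixes p :: "'n::finite rpoly"
  assumes "p \<noteq> 0"
  obtains a where "a \<in> Poly_Mapping.keys p" "expo_deg a = poly_deg p"
    "\<And>b. b \<in> Poly_Mapping.keys p \<Longrightarrow> expo_deg b = poly_deg p \<Longrightarrow> nat_expo b \<le> nat_expo a"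
proof -
  let ?T = "{a \<in> Poly_Mapping.keys p. expo_deg a = poly_deg p}"
  have fin: "finite (nat_expo ` ?T)" by simp
  have "?T \<noteq> {}" using poly_deg_attained[OF assms] by blast
  then have ne: "nat_expo ` ?T \<noteq> {}" by blast
  from Max_in[OF fin ne] obtain a where a: "Max (nat_expo ` ?T) = nat_expo a" "a \<in> ?T"
    by (rule imageE)
  show ?thesis
  proof (rule that[of a])
    fix b assume "b \<in> Poly_Mapping.keys p" "expo_deg b = poly_deg p"
    then have "nat_expo b \<le> Max (nat_expo ` ?T)" by (intro Max_ge[OF fin] imageI) simp
    then show "nat_expo b \<le> nat_expo a" using a(1) by simp
  qed (use a(2) in auto)
qed

lemma poly_deg_mult:
  fixes p q :: "'n::finite rpoly"
  assumes "p \<noteq> 0" "q \<noteq> 0"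
  shows "p * q \<noteq> 0" "poly_deg (p * q) = poly_deg p + poly_deg q"
proof -
  obtain a where a: "a \<in> Poly_Mapping.keys p" "expo_deg a = poly_deg p"
    "\<And>b. b \<in> Poly_Mapping.keys p \<Longrightarrow> expo_deg b = poly_deg p \<Longrightarrow> nat_expo b \<le> nat_expo a"
    using poly_deg_leading[OF assms(1)] by blast
  obtain b where b: "b \<in> Poly_Mapping.keys q" "expo_deg b = poly_deg q"
    "\<And>c. c \<in> Poly_Mapping.keys q \<Longrightarrow> expo_deg c = poly_deg q \<Longrightarrow> nat_expo c \<le> nat_expo b"
    using poly_deg_leading[OF assms(2)] by blast
  have uniq: "a' = a \<and> b' = b"
    if "a' \<in> Poly_Mapping.keys p" "b' \<in> Poly_Mapping.keys q" "a' + b' = a + b" for a' b'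
  proof -
    have "expo_deg a' + expo_deg b' = poly_deg p + poly_deg q"
      using that(3) a(2) b(2) by (metis expo_deg_add)
    moreover have "expo_deg a' \<le> poly_deg p" "expo_deg b' \<le> poly_deg q"
      using that by (auto intro: expo_deg_le_poly_deg)
    ultimately have "expo_deg a' = poly_deg p" "expo_deg b' = poly_deg q" by linarith+
    then have le: "nat_expo a' \<le> nat_expo a" "nat_expo b' \<le> nat_expo b"
      using a(3) b(3) that by auto
    have sum: "nat_expo a' + nat_expo b' = nat_expo a + nat_expo b"
      using that(3) by (metis nat_expo_add)
    have "nat_expo a' = nat_expo a"
    proof (rule ccontr)
      assume "nat_expo a' \<noteq> nat_expo a"
      then have "nat_expo a' + nat_expo b' < nat_expo a + nat_expo b"
        using le by (intro add_less_le_mono) auto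
      then show False using sum by simp
    qed
    then show ?thesis using sum inj_nat_expo by auto
  qed
  have "p * q = (\<Sum>a'\<in>Poly_Mapping.keys p. Poly_Mapping.single a' (Poly_Mapping.lookup p a')) *
      (\<Sum>b'\<in>Poly_Mapping.keys q. Poly_Mapping.single b' (Poly_Mapping.lookup q b'))"
    by (metis poly_expand finite_keys order_refl)
  also have "\<dots> = (\<Sum>a'\<in>Poly_Mapping.keys p. \<Sum>b'\<in>Poly_Mapping.keys q.
      Poly_Mapping.single (a' + b') (Poly_Mapping.lookup p a' * Poly_Mapping.lookup q b'))"
    by (simp add: sum_product mult_single)
  finally have "Poly_Mapping.lookup (p * q) (a + b) =
      (\<Sum>a'\<in>Poly_Mapping.keys p. \<Sum>b'\<in>Poly_Mapping.keys q.
        Poly_Mapping.lookup (Poly_Mapping.single (a' + b')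
          (Poly_Mapping.lookup p a' * Poly_Mapping.lookup q b')) (a + b))"
    by (simp add: lookup_sum)
  also have "\<dots> = (\<Sum>a'\<in>Poly_Mapping.keys p. \<Sum>b'\<in>Poly_Mapping.keys q.
      if b' = b then (if a' = a then Poly_Mapping.lookup p a * Poly_Mapping.lookup q b else 0) else 0)"
    by (intro sum.cong refl) (use uniq in \<open>auto simp: lookup_single when_def\<close>)
  also have "\<dots> = Poly_Mapping.lookup p a * Poly_Mapping.lookup q b"
    using a(1) b(1) by (simp add: sum.delta)
  also have "\<dots> \<noteq> 0" using a(1) b(1) by (simp add: in_keys_iff)
  finally have key: "a + b \<in> Poly_Mapping.keys (p * q)" by (simp add: in_keys_iff)
  then show nz: "p * q \<noteq> 0" by auto
  have "poly_deg (p * q) \<ge> poly_deg p + poly_deg q"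
    using expo_deg_le_poly_deg[OF key] a(2) b(2) by (simp add: expo_deg_add)
  moreover obtain c where c: "c \<in> Poly_Mapping.keys (p * q)" "expo_deg c = poly_deg (p * q)"
    using poly_deg_attained[OF nz] by blast
  then obtain a' b' where "c = a' + b'" "a' \<in> Poly_Mapping.keys p" "b' \<in> Poly_Mapping.keys q"
    using keys_mult[of p q] by blast
  then have "poly_deg (p * q) \<le> poly_deg p + poly_deg q"
    using c(2) expo_deg_le_poly_deg[of a' p] expo_deg_le_poly_deg[of b' q]
    by (simp add: expo_deg_add)
  ultimately show "poly_deg (p * q) = poly_deg p + poly_deg q" by simp
qed

lemma finite_expos_upto: "finite (expos_upto d :: 'n::finite expo set)"
proof -
  have "Poly_Mapping.lookup ` (expos_upto d :: 'n expo set) \<subseteq> PiE UNIV (\<lambda>_. {..d})"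
  proof (intro image_subsetI PiE_I)
    fix a :: "'n expo" and i :: 'n
    assume "a \<in> expos_upto d"
    then have "expo_deg a \<le> d" by (simp add: expos_upto_def)
    moreover have "Poly_Mapping.lookup a i \<le> expo_deg a"
      unfolding expo_deg_def by (rule member_le_sum) auto
    ultimately show "Poly_Mapping.lookup a i \<in> {..d}" by simp
  qed simp
  moreover have "finite (PiE (UNIV :: 'n set) (\<lambda>_. {..d}))" by (intro finite_PiE) auto
  ultimately have "finite (Poly_Mapping.lookup ` (expos_upto d :: 'n expo set))"
    by (rule finite_subset)
  then show ?thesis
    by (rule finite_imageD) (simp add: inj_on_def poly_mapping.lookup_inject)
qed

lemma finite_loc_index: "finite (loc_index k q)"
  by (rule finite_subset[OF _ finite_expos_upto[of k]]) (auto simp: loc_index_def expos_upto_def)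

lemma keys_subset_loc_index:
  assumes "q \<noteq> 0" "poly_deg (q * p\<^sup>2) \<le> 2 * k"
  shows "Poly_Mapping.keys p \<subseteq> loc_index k q"
proof (cases "p = 0")
  case False
  then have "poly_deg (q * p\<^sup>2) = poly_deg q + 2 * poly_deg p"
    using assms(1) poly_deg_mult[of p p] poly_deg_mult(2)[of q "p * p"]
    by (simp add: power2_eq_square)
  then show ?thesis
    using assms(2) expo_deg_le_poly_deg[of _ p] by (fastforce simp: loc_index_def)
qed simp


subsection \<open>The localizing matrix is well defined\<close>

lemma riesz_superset:
  assumes "finite S" "Poly_Mapping.keys p \<subseteq> S"
  shows "riesz z p = (\<Sum>\<alpha>\<in>S. Poly_Mapping.lookup p \<alpha> * z \<alpha>)"
  unfolding riesz_def by (rule sum.mono_neutral_left) (use assms in \<open>auto simp: in_keys_iff\<close>)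

lemma riesz_zero [simp]: "riesz z 0 = 0"
  by (simp add: riesz_def)

lemma riesz_add: "riesz z (p + q) = riesz z p + riesz z q"
proof -
  let ?S = "Poly_Mapping.keys p \<union> Poly_Mapping.keys q"
  have "riesz z (p + q) = (\<Sum>\<alpha>\<in>?S. Poly_Mapping.lookup (p + q) \<alpha> * z \<alpha>)"
    by (rule riesz_superset) (auto dest: subsetD[OF keys_add])
  moreover have "riesz z p = (\<Sum>\<alpha>\<in>?S. Poly_Mapping.lookup p \<alpha> * z \<alpha>)"
    by (rule riesz_superset) auto
  moreover have "riesz z q = (\<Sum>\<alpha>\<in>?S. Poly_Mapping.lookup q \<alpha> * z \<alpha>)"
    by (rule riesz_superset) auto
  ultimately show ?thesis by (simp add: lookup_add algebra_simps sum.distrib)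
qed

lemma riesz_sum: "riesz z (\<Sum>i\<in>I. f i) = (\<Sum>i\<in>I. riesz z (f i))"
  by (induction I rule: infinite_finite_induct) (auto simp: riesz_add)

lemma riesz_const_mult: "riesz z (const_poly c * p) = c * riesz z p"
proof -
  have lk: "Poly_Mapping.lookup (const_poly c * p) \<alpha> = c * Poly_Mapping.lookup p \<alpha>" for \<alpha>
    by (auto simp: const_poly_def mult_map_scale_conv_mult[symmetric] Poly_Mapping.map.rep_eq when_def)
  have "riesz z (const_poly c * p)
      = (\<Sum>\<alpha>\<in>Poly_Mapping.keys p. Poly_Mapping.lookup (const_poly c * p) \<alpha> * z \<alpha>)"
    by (rule riesz_superset) (auto simp: in_keys_iff lk)
  then show ?thesis by (simp add: lk riesz_def sum_distrib_left mult.assoc)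
qed

lemma single_conv_xpow: "Poly_Mapping.single a c = const_poly c * xpow a"
  by (simp add: const_poly_def xpow_def mult_single)

lemma is_localizing_matrix_entries:
  fixes q :: "'n::finite rpoly"
  shows "is_localizing_matrix k q z
    (\<lambda>\<beta> \<gamma>. if \<beta> \<in> loc_index k q \<and> \<gamma> \<in> loc_index k q then riesz z (q * xpow \<beta> * xpow \<gamma>) else 0)"
    (is "is_localizing_matrix k q z ?M")
  unfolding is_localizing_matrix_def
proof (intro conjI allI impI)
  fix p :: "'n rpoly"
  let ?I = "loc_index k q"
  let ?c = "Poly_Mapping.lookup p"
  assume deg: "poly_deg (q * p\<^sup>2) \<le> 2 * k"
  show "riesz z (q * p\<^sup>2) = (\<Sum>\<beta>\<in>?I. \<Sum>\<gamma>\<in>?I. ?c \<beta> * ?M \<beta> \<gamma> * ?c \<gamma>)"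
  proof (cases "q = 0")
    case True
    then show ?thesis by (simp cong: if_cong)
  next
    case False
    have p: "p = (\<Sum>\<beta>\<in>?I. const_poly (?c \<beta>) * xpow \<beta>)"
      using poly_expand[OF finite_loc_index keys_subset_loc_index[OF False deg]]
      by (simp only: single_conv_xpow)
    have pp: "p * p = (\<Sum>\<beta>\<in>?I. const_poly (?c \<beta>) * xpow \<beta>) *
        (\<Sum>\<gamma>\<in>?I. const_poly (?c \<gamma>) * xpow \<gamma>)"
      by (rule arg_cong2[where f = "(*)", OF p p])
    have "q * p\<^sup>2 = q * ((\<Sum>\<beta>\<in>?I. const_poly (?c \<beta>) * xpow \<beta>) *
        (\<Sum>\<gamma>\<in>?I. const_poly (?c \<gamma>) * xpow \<gamma>))"
      by (simp only: power2_eq_square pp)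
    also have "\<dots> = (\<Sum>\<beta>\<in>?I. \<Sum>\<gamma>\<in>?I.
        const_poly (?c \<beta>) * (const_poly (?c \<gamma>) * (q * xpow \<beta> * xpow \<gamma>)))"
      by (simp add: sum_product sum_distrib_left mult_ac)
    finally have "riesz z (q * p\<^sup>2) = riesz z (\<Sum>\<beta>\<in>?I. \<Sum>\<gamma>\<in>?I.
        const_poly (?c \<beta>) * (const_poly (?c \<gamma>) * (q * xpow \<beta> * xpow \<gamma>)))"
      by (rule arg_cong)
    also have "\<dots> = (\<Sum>\<beta>\<in>?I. \<Sum>\<gamma>\<in>?I. ?c \<beta> * ?M \<beta> \<gamma> * ?c \<gamma>)"
      unfolding riesz_sum riesz_const_mult by (intro sum.cong refl) simp
    finally show ?thesis .
  qed
qed (auto simp: mult_ac split: if_splits)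

lemma is_localizing_matrix_unique:
  fixes q :: "'n::finite rpoly"
  assumes M: "is_localizing_matrix k q z M" and N: "is_localizing_matrix k q z N"
  shows "M = N"
proof -
  let ?I = "loc_index k q"
  define D where "D = (\<lambda>\<beta> \<gamma>. M \<beta> \<gamma> - N \<beta> \<gamma>)"
  have D0: "D \<beta> \<gamma> = 0" if "\<not> (\<beta> \<in> ?I \<and> \<gamma> \<in> ?I)" for \<beta> \<gamma>
  proof -
    have "M \<beta> \<gamma> = 0" "N \<beta> \<gamma> = 0"
      using M N that unfolding is_localizing_matrix_def by blast+
    then show ?thesis by (simp add: D_def)
  qed
  have Dsym: "D \<beta> \<gamma> = D \<gamma> \<beta>" for \<beta> \<gamma>
  proof -
    have "M \<beta> \<gamma> = M \<gamma> \<beta>" "N \<beta> \<gamma> = N \<gamma> \<beta>"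
      using M N unfolding is_localizing_matrix_def by blast+
    then show ?thesis by (simp add: D_def)
  qed
  have form: "(\<Sum>\<beta>\<in>?I. \<Sum>\<gamma>\<in>?I. Poly_Mapping.lookup p \<beta> * D \<beta> \<gamma> * Poly_Mapping.lookup p \<gamma>) = 0"
    if "poly_deg (q * p\<^sup>2) \<le> 2 * k" for p
  proof -
    have "(\<Sum>\<beta>\<in>?I. \<Sum>\<gamma>\<in>?I. Poly_Mapping.lookup p \<beta> * M \<beta> \<gamma> * Poly_Mapping.lookup p \<gamma>) =
      (\<Sum>\<beta>\<in>?I. \<Sum>\<gamma>\<in>?I. Poly_Mapping.lookup p \<beta> * N \<beta> \<gamma> * Poly_Mapping.lookup p \<gamma>)"
      using conjunct2[OF conjunct2[OF M[unfolded is_localizing_matrix_def]], rule_format, OF that]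
        conjunct2[OF conjunct2[OF N[unfolded is_localizing_matrix_def]], rule_format, OF that]
      by simp
    then show ?thesis by (simp only: D_def right_diff_distrib left_diff_distrib sum_subtractf)
  qed
  have deg: "poly_deg (q * p\<^sup>2) \<le> 2 * k" if "Poly_Mapping.keys p \<subseteq> ?I" for p
  proof (cases "p = 0 \<or> q = 0")
    case True
    then show ?thesis by (auto simp: poly_deg_def)
  next
    case False
    then obtain b where "b \<in> Poly_Mapping.keys p" "expo_deg b = poly_deg p"
      using poly_deg_attained by blast
    then have "poly_deg q + 2 * poly_deg p \<le> 2 * k" using that by (auto simp: loc_index_def)
    then show ?thesis
      using False poly_deg_mult[of p p] poly_deg_mult(2)[of q "p * p"]
      by (simp add: power2_eq_square)
  qed
  have xp: "Poly_Mapping.lookup (xpow a) b = (if b = a then 1 else 0)" for a b :: "'n expo"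
    by (auto simp: xpow_def lookup_single when_def)
  have bil: "(\<Sum>\<beta>\<in>?I. \<Sum>\<gamma>\<in>?I. (if \<beta> = a then 1 else 0) * D \<beta> \<gamma> * (if \<gamma> = b then 1 else 0)) = D a b"
    if "a \<in> ?I" "b \<in> ?I" for a b
  proof -
    have "(\<Sum>\<beta>\<in>?I. \<Sum>\<gamma>\<in>?I. (if \<beta> = a then 1 else 0) * D \<beta> \<gamma> * (if \<gamma> = b then 1 else 0)) =
      (\<Sum>\<beta>\<in>?I. \<Sum>\<gamma>\<in>?I. if \<gamma> = b then (if \<beta> = a then D a b else 0) else 0)"
      by (intro sum.cong) auto
    then show ?thesis using that finite_loc_index[of k q] by (simp add: sum.delta)
  qed
  have diag: "D a a = 0" if "a \<in> ?I" for a
  proof -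
    have "Poly_Mapping.keys (xpow a :: 'n rpoly) \<subseteq> ?I" using that by (simp add: xpow_def)
    from form[OF deg, OF this] show ?thesis using bil[OF that that] by (simp only: xp)
  qed
  have "D a b = 0" if ab: "a \<in> ?I" "b \<in> ?I" for a b
  proof -
    have "Poly_Mapping.keys (xpow a + xpow b :: 'n rpoly) \<subseteq> ?I"
      using keys_add[of "xpow a" "xpow b :: 'n rpoly"] ab by (auto simp: xpow_def)
    from form[OF deg, OF this]
    have "(\<Sum>\<beta>\<in>?I. \<Sum>\<gamma>\<in>?I. ((if \<beta> = a then 1 else 0) + (if \<beta> = b then 1 else 0)) * D \<beta> \<gamma> *
       ((if \<gamma> = a then 1 else 0) + (if \<gamma> = b then 1 else 0))) = 0"
      by (simp only: lookup_add xp)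
    then have "D a a + D a b + (D b a + D b b) = 0"
      using bil[of a a] bil[of a b] bil[of b a] bil[of b b] ab
      by (simp only: distrib_left distrib_right sum.distrib)
    then show ?thesis using diag ab Dsym[of a b] by simp
  qed
  then have "D a b = 0" for a b using D0 by blast
  then show ?thesis by (auto simp: D_def fun_eq_iff)
qed

theorem ex1_localizing_matrix: "\<exists>!M. is_localizing_matrix k q z M"
  using is_localizing_matrix_entries is_localizing_matrix_unique by blast

theorem localizing_matrix_entry:
  assumes "\<beta> \<in> loc_index k q" "\<gamma> \<in> loc_index k q"
  shows "localizing_matrix k q z \<beta> \<gamma> = riesz z (q * xpow \<beta> * xpow \<gamma>)"
proof -
  have "localizing_matrix k q z =
    (\<lambda>\<beta> \<gamma>. if \<beta> \<in> loc_index k q \<and> \<gamma> \<in> loc_index k q then riesz z (q * xpow \<beta> * xpow \<gamma>) else 0)"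
    unfolding localizing_matrix_def
    by (rule the_equality)
      (use is_localizing_matrix_entries is_localizing_matrix_unique in blast)+
  then show ?thesis using assms by simp
qed

end

theory Submission
  imports Defs
begin

text \<open>
  For the nontrivial inclusion, let \<open>z\<^sub>k\<close> be a feasible point of the \<open>k\<close>-th relaxation that
  restricts to \<open>y\<close>. The archimedean property bounds every moment of \<open>z\<^sub>k\<close> by its mass, so the
  normalised sequence has a limit \<open>L\<close>, a functional on all polynomials that is nonnegative on
  \<open>I(h) + Q(g)\<close> and grows geometrically.

  Such an \<open>L\<close> is nonnegative on every polynomial that is positive on \<open>K\<close>. By Cauchy-Schwarz the
  sequence \<open>L(m x\<^sub>i\<^sup>2\<^sup>j f\<^sup>2)\<close> is log-convex in \<open>j\<close>, hence its geometric growth forces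
  \<open>L(m (\<rho> \<plusminus> x\<^sub>i) f\<^sup>2) \<ge> 0\<close> whenever \<open>L(m f\<^sup>2) \<ge> 0\<close> for all \<open>f\<close>; Bernstein expansions then give
  nonnegativity on polynomials positive on a box, and a polynomial penalty built from \<open>g\<close> and \<open>h\<close>
  passes from the box to \<open>K\<close>. Fullness excludes that the normalising factors tend to 0, and a
  finite-dimensional functional that is nonnegative on the functions nonnegative on \<open>K\<close> is a
  finite sum of point evaluations. This avoids both Putinar's theorem and the Riesz
  representation theorem.
\<close>

subsection \<open>Finitely atomic representation\<close>

text \<open>Tychonoff's theorem for a product of compact intervals, since functions carry the
  product topology. It serves twice: for normalised coefficient vectors and for bounded moment
  sequences.\<close>

lemma compact_bounded_functions:
  fixes B :: "'a \<Rightarrow> real"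
  shows "compact {w :: 'a \<Rightarrow> real. \<forall>a. \<bar>w a\<bar> \<le> B a}"
proof -
  have eq: "{w :: 'a \<Rightarrow> real. \<forall>a. \<bar>w a\<bar> \<le> B a} = PiE UNIV (\<lambda>a. {- B a..B a})"
    by (auto simp: PiE_iff abs_le_iff minus_le_iff[of "w a" "B a" for w a])
  have "compactin (product_topology (\<lambda>_::'a. euclidean :: real topology) UNIV)
      (PiE UNIV (\<lambda>a. {- B a..B a}))"
    by (simp add: compactin_PiE)
  then show ?thesis
    by (simp add: eq euclidean_product_topology[symmetric] flip: compactin_euclidean_iff)
qed

text \<open>Where \<open>f\<close> is nonpositive, \<open>q\<close> has a positive minimum by
  compactness, so a large multiple of \<open>q\<close> outweighs the minimum of \<open>f\<close>;
  elsewhere the penalty does no harm.\<close>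

lemma compact_penalty_positive:
  fixes f q :: "'a::t2_space \<Rightarrow> real"
  assumes X: "compact X" and f: "continuous_on X f" and q: "continuous_on X q"
    and q_nonneg: "\<And>x. x \<in> X \<Longrightarrow> 0 \<le> q x"
    and pos: "\<And>x. x \<in> X \<Longrightarrow> q x = 0 \<Longrightarrow> 0 < f x"
  obtains l where "0 \<le> l" "\<And>x. x \<in> X \<Longrightarrow> 0 < f x + l * q x"
proof -
  define S where "S = X \<inter> f -` {..0}"
  have S: "compact S" unfolding S_def
    by (rule closedin_compact[OF X continuous_closedin_preimage[OF f]]) simp
  show ?thesis
  proof (cases "S = {}")
    case True
    then have "0 < f x + 0 * q x" if "x \<in> X" for x using that by (force simp: S_def)
    then show ?thesis using that[of 0] by blast
  next
    case False
    have sub: "S \<subseteq> X" by (auto simp: S_def)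
    obtain a where a: "a \<in> S" "\<And>x. x \<in> S \<Longrightarrow> q a \<le> q x"
      using continuous_attains_inf[OF S False continuous_on_subset[OF q sub]] by blast
    obtain b where b: "b \<in> S" "\<And>x. x \<in> S \<Longrightarrow> f b \<le> f x"
      using continuous_attains_inf[OF S False continuous_on_subset[OF f sub]] by blast
    have qa: "0 < q a"
      using a(1) q_nonneg[of a] pos[of a] by (force simp: S_def)
    have fb: "f b \<le> 0" using b(1) by (simp add: S_def)
    \<comment> \<open>Chosen so that \<open>l * q a = 1 - f b\<close>, which lifts the sum to at
      least 1 on \<open>S\<close>.\<close>
    define l where "l = (1 - f b) / q a"
    have l: "0 \<le> l" using fb qa by (simp add: l_def)
    show ?thesis
    proof (rule that[OF l])
      fix x assume x: "x \<in> X"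
      show "0 < f x + l * q x"
      proof (cases "x \<in> S")
        case True
        have "l * q a \<le> l * q x" using a(2)[OF True] l by (rule mult_left_mono)
        moreover have "l * q a = 1 - f b" using qa by (simp add: l_def)
        ultimately show ?thesis using b(2)[OF True] by linarith
      next
        case False
        then have "0 < f x" using x by (auto simp: S_def not_le)
        then show ?thesis using l q_nonneg[OF x] by (simp add: add_pos_nonneg)
      qed
    qed
  qed
qed

text \<open>Within the dual of the cone of nonnegative combinations, \<open>y\<close> is moved in
  the direction opposite to evaluation at \<open>x\<close> until it reaches the boundary.
  Compactness of the normalised cone elements then provides a nonzero coefficient vector that the
  boundary functional annihilates.\<close>

lemma nonneg_cone_boundary:
  fixes e :: "'b \<Rightarrow> 'a \<Rightarrow> real"
  assumes B: "finite B"
    and nonneg: "\<And>c. (\<And>z. z \<in> K \<Longrightarrow> 0 \<le> (\<Sum>b\<in>B. c b * e b z)) \<Longrightarrow> 0 \<le> (\<Sum>b\<in>B. c b * y b)"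
    and pos: "\<And>z. z \<in> K \<Longrightarrow> 0 < (\<Sum>b\<in>B. c0 b * e b z)"
    and x: "x \<in> K"
  obtains t c where "0 \<le> t" "\<exists>b\<in>B. c b \<noteq> 0" "\<And>z. z \<in> K \<Longrightarrow> 0 \<le> (\<Sum>b\<in>B. c b * e b z)"
    "(\<Sum>b\<in>B. c b * (y b - t * e b x)) = 0"
    "\<And>c. (\<And>z. z \<in> K \<Longrightarrow> 0 \<le> (\<Sum>b\<in>B. c b * e b z)) \<Longrightarrow> 0 \<le> (\<Sum>b\<in>B. c b * (y b - t * e b x))"
proof -
  \<comment> \<open>The vectors of l1-norm 1 in the cone. Coordinates outside \<open>B\<close> are
    pinned to 0, as they would otherwise be unbounded and destroy compactness.\<close>
  define P where "P = {c :: 'b \<Rightarrow> real. \<forall>b. \<bar>c b\<bar> \<le> (if b \<in> B then 1 else 0)} \<inter>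
    ({c. (\<Sum>b\<in>B. \<bar>c b\<bar>) = 1} \<inter> (\<Inter>z\<in>K. {c. 0 \<le> (\<Sum>b\<in>B. c b * e b z)}))"
  define \<phi> where "\<phi> = (\<lambda>c :: 'b \<Rightarrow> real. \<Sum>b\<in>B. c b * y b)"
  define \<psi> where "\<psi> = (\<lambda>c :: 'b \<Rightarrow> real. \<Sum>b\<in>B. c b * e b x)"
  define S where "S = (\<Sum>b\<in>B. \<bar>e b x\<bar>)"
  have cont: "continuous_on UNIV (\<lambda>c :: 'b \<Rightarrow> real. \<Sum>b\<in>B. c b * u b)" for u
    by (intro continuous_intros continuous_on_product_coordinates)
  have P: "compact P" unfolding P_def
    by (intro compact_Int_closed compact_bounded_functions closed_Int closed_INT ballI
        closed_Collect_eq closed_Collect_le cont continuous_intros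
            continuous_on_product_coordinates)
  have normalize: "\<exists>s>0. \<exists>d\<in>P. \<forall>b\<in>B. c b = s * d b"
    if c: "\<And>z. z \<in> K \<Longrightarrow> 0 \<le> (\<Sum>b\<in>B. c b * e b z)" and nz: "\<exists>b\<in>B. c b \<noteq> 0" for c
  proof -
    define s where "s = (\<Sum>b\<in>B. \<bar>c b\<bar>)"
    have s: "0 < s" using nz B by (auto simp: s_def intro: sum_pos2)
    define d where "d = (\<lambda>b. if b \<in> B then c b / s else 0)"
    have "\<bar>c b\<bar> \<le> s" if "b \<in> B" for b
      unfolding s_def using that B by (intro member_le_sum) auto
    then have "\<bar>d b\<bar> \<le> (if b \<in> B then 1 else 0)" for b
      using s by (simp add: d_def abs_divide)
    moreover have "(\<Sum>b\<in>B. \<bar>d b\<bar>) = (\<Sum>b\<in>B. \<bar>c b\<bar> / s)"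
      using s by (intro sum.cong) (auto simp: d_def)
    moreover have "(\<Sum>b\<in>B. d b * e b z) = (\<Sum>b\<in>B. c b * e b z) / s" for z
      unfolding sum_divide_distrib by (intro sum.cong) (auto simp: d_def)
    ultimately have "d \<in> P"
      using s c by (auto simp: P_def simp flip: sum_divide_distrib s_def)
    then show ?thesis using s by (intro exI[of _ s] conjI bexI[of _ d]) (auto simp: d_def)
  qed
  have \<phi>_nonneg: "0 \<le> \<phi> c" if "c \<in> P" for c
    unfolding \<phi>_def using that by (intro nonneg) (auto simp: P_def)
  have \<psi>_nonneg: "0 \<le> \<psi> c" if "c \<in> P" for c
    using that x by (auto simp: P_def \<psi>_def)
  have \<psi>_le: "\<psi> c \<le> S" if "c \<in> P" for c
    unfolding \<psi>_def S_def
  proof (rule sum_mono)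
    fix b assume "b \<in> B"
    then have "\<bar>c b\<bar> \<le> 1" using that by (auto simp: P_def split: if_splits)
    then have "\<bar>c b\<bar> * \<bar>e b x\<bar> \<le> 1 * \<bar>e b x\<bar>" by (intro mult_right_mono) auto
    then show "c b * e b x \<le> \<bar>e b x\<bar>" by (simp flip: abs_mult)
  qed
  have S: "0 \<le> S" by (simp add: S_def sum_nonneg)
  \<comment> \<open>The strictly positive combination normalises to some \<open>c1\<close> with
    \<open>\<psi> c1 > 0\<close>, which bounds the admissible multiples \<open>T\<close> from
    above.\<close>
  have "\<exists>b\<in>B. c0 b \<noteq> 0"
  proof (rule ccontr)
    assume "\<not> (\<exists>b\<in>B. c0 b \<noteq> 0)"
    then have "(\<Sum>b\<in>B. c0 b * e b x) = 0" by simp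
    then show False using pos[OF x] by simp
  qed
  then obtain s c1 where s: "s > 0" and c1: "c1 \<in> P" and c0: "\<forall>b\<in>B. c0 b = s * c1 b"
    using normalize[of c0] pos by (meson less_imp_le)
  have "(\<Sum>b\<in>B. c0 b * e b x) = s * \<psi> c1"
    unfolding \<psi>_def sum_distrib_left by (intro sum.cong) (auto simp: c0)
  then have \<psi>c1: "0 < \<psi> c1" using pos[OF x] s by (simp add: zero_less_mult_iff)
  define T where "T = {t. \<forall>c\<in>P. t * \<psi> c \<le> \<phi> c}"
  have T0: "0 \<in> T" using \<phi>_nonneg by (simp add: T_def)
  have bdd: "bdd_above T"
    using c1 \<psi>c1 by (intro bdd_aboveI[of _ "\<phi> c1 / \<psi> c1"]) (auto simp: T_def pos_le_divide_eq)
  define t where "t = Sup T"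
  have t: "0 \<le> t" unfolding t_def by (rule cSup_upper[OF T0 bdd])
  have tT: "t * \<psi> c \<le> \<phi> c" if c: "c \<in> P" for c
  proof (cases "\<psi> c = 0")
    case False
    then have "0 < \<psi> c" using \<psi>_nonneg[OF c] by simp
    moreover from this have "t \<le> \<phi> c / \<psi> c"
      unfolding t_def
    proof (intro cSup_least)
      show "T \<noteq> {}" using T0 by blast
    qed (use c in \<open>auto simp: T_def pos_le_divide_eq\<close>)
    ultimately show ?thesis by (simp add: pos_le_divide_eq)
  qed (use \<phi>_nonneg[OF c] in simp)
  have "continuous_on P (\<lambda>c. \<phi> c - t * \<psi> c)"
    unfolding \<phi>_def \<psi>_def
    by (intro continuous_intros continuous_on_subset[OF cont]) auto
  then obtain c where c: "c \<in> P" and cmin: "\<And>d. d \<in> P \<Longrightarrow> \<phi> c - t * \<psi> c \<le> \<phi> d - t * \<psi> d"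
    using continuous_attains_inf[OF P] c1 by blast
  define m where "m = \<phi> c - t * \<psi> c"
  \<comment> \<open>With a positive minimum \<open>m\<close>, the multiple \<open>t\<close> could
    still grow by \<open>m / (S + 1)\<close>, since \<open>\<psi>\<close> is at most
    \<open>S\<close> on \<open>P\<close>; the summand 1 keeps the denominator positive.\<close>
  have m: "m = 0"
  proof (rule ccontr)
    assume "m \<noteq> 0"
    then have m: "0 < m" using tT[OF c] by (simp add: m_def)
    have "t + m / (S + 1) \<in> T"
      unfolding T_def
    proof (intro CollectI ballI)
      fix d assume d: "d \<in> P"
      have "m / (S + 1) * \<psi> d \<le> m / (S + 1) * (S + 1)"
        using \<psi>_le[OF d] S m by (intro mult_left_mono) auto
      also have "\<dots> = m" using S by simp
      finally show "(t + m / (S + 1)) * \<psi> d \<le> \<phi> d"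
        using cmin[OF d] by (simp add: m_def distrib_right)
    qed
    then have "t + m / (S + 1) \<le> t" unfolding t_def using bdd by (rule cSup_upper)
    then show False using m S by (simp add: divide_le_0_iff)
  qed
  have split: "(\<Sum>b\<in>B. d b * (y b - t * e b x)) = \<phi> d - t * \<psi> d" for d
    by (simp add: \<phi>_def \<psi>_def right_diff_distrib sum_subtractf sum_distrib_left mult_ac)
  have nz: "\<exists>b\<in>B. c b \<noteq> 0"
  proof (rule ccontr)
    assume "\<not> (\<exists>b\<in>B. c b \<noteq> 0)"
    then have "(\<Sum>b\<in>B. \<bar>c b\<bar>) = 0" by simp
    then show False using c by (auto simp: P_def)
  qed
  show ?thesis
  proof (rule that[OF t nz])
    show "0 \<le> (\<Sum>b\<in>B. c b * e b z)" if "z \<in> K" for z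
      using c that by (auto simp: P_def)
    show "(\<Sum>b\<in>B. c b * (y b - t * e b x)) = 0"
      using m by (simp add: split m_def)
    fix d assume d: "\<And>z. z \<in> K \<Longrightarrow> 0 \<le> (\<Sum>b\<in>B. d b * e b z)"
    show "0 \<le> (\<Sum>b\<in>B. d b * (y b - t * e b x))"
    proof (cases "\<exists>b\<in>B. d b \<noteq> 0")
      case True
      then obtain s d' where s: "s > 0" and d': "d' \<in> P" "\<forall>b\<in>B. d b = s * d' b"
        using normalize[of d] d by blast
      have "(\<Sum>b\<in>B. d b * (y b - t * e b x)) = s * (\<Sum>b\<in>B. d' b * (y b - t * e b x))"
        unfolding sum_distrib_left by (intro sum.cong) (auto simp: d')
      then show ?thesis using tT[OF d'(1)] s by (simp add: split)
    qed simp
  qed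
qed

text \<open>
  Subtracting the largest admissible multiple of a point evaluation leaves a functional that
  annihilates some \<open>p \<ge> 0\<close> with nonzero coefficient vector. On the zero set of \<open>p\<close> one basis
  function becomes redundant, which reduces the dimension.
\<close>

lemma nonneg_functional_finite_atomic:
  fixes e :: "'b \<Rightarrow> 'a::t2_space \<Rightarrow> real"
  assumes "finite B" and "compact K" and "\<And>b. b \<in> B \<Longrightarrow> continuous_on K (e b)"
    and "\<And>c. (\<And>z. z \<in> K \<Longrightarrow> 0 \<le> (\<Sum>b\<in>B. c b * e b z)) \<Longrightarrow> 0 \<le> (\<Sum>b\<in>B. c b * y b)"
    and "\<And>z. z \<in> K \<Longrightarrow> 0 < (\<Sum>b\<in>B. c0 b * e b z)"
  shows "\<exists>F t. finite F \<and> F \<subseteq> K \<and> (\<forall>z\<in>F. 0 \<le> t z) \<and> (\<forall>b\<in>B. y b = (\<Sum>z\<in>F. t z * e b z))"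
  using assms
proof (induction B arbitrary: K y c0 rule: finite_psubset_induct)
  case (psubset B)
  show ?case
  proof (cases "K = {}")
    case True
    \<comment> \<open>On the empty set every coefficient vector is admissible, so testing with
      \<open>- y\<close> forces \<open>y\<close> to vanish on \<open>B\<close>.\<close>
    have "0 \<le> (\<Sum>b\<in>B. - y b * y b)" by (rule psubset.prems(3)) (use True in auto)
    then have "(\<Sum>b\<in>B. y b * y b) \<le> 0" by (simp add: sum_negf)
    then have "(\<Sum>b\<in>B. y b * y b) = 0" by (intro antisym sum_nonneg) auto
    then have "\<forall>b\<in>B. y b = 0" using psubset.hyps by (subst (asm) sum_nonneg_eq_0_iff) auto
    then show ?thesis by (intro exI[of _ "{}"]) auto
  next
    case False
    then obtain x where x: "x \<in> K" by blast
    obtain t c where t: "0 \<le> t" and nz: "\<exists>b\<in>B. c b \<noteq> 0"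
      and c: "\<And>z. z \<in> K \<Longrightarrow> 0 \<le> (\<Sum>b\<in>B. c b * e b z)"
      and c0: "(\<Sum>b\<in>B. c b * (y b - t * e b x)) = 0"
      and pos: "\<And>d. (\<And>z. z \<in> K \<Longrightarrow> 0 \<le> (\<Sum>b\<in>B. d b * e b z)) \<Longrightarrow>
        0 \<le> (\<Sum>b\<in>B. d b * (y b - t * e b x))"
      by (rule nonneg_cone_boundary[where e = e and K
          = K, OF psubset.hyps psubset.prems(3,4) x]) blast+
    from nz obtain b0 where b0: "b0 \<in> B" "c b0 \<noteq> 0" by blast
    define y' where "y' = (\<lambda>b. y b - t * e b x)"
    define B' where "B' = B - {b0}"
    define K' where "K' = K \<inter> (\<lambda>z. \<Sum>b\<in>B. c b * e b z) -` {0}"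
    have cont: "continuous_on K (\<lambda>z. \<Sum>b\<in>B. d b * e b z)" for d
      using psubset.prems(2) by (intro continuous_intros) auto
    have K': "compact K'" unfolding K'_def
      by (rule closedin_compact[OF psubset.prems(1) continuous_closedin_preimage[OF cont]]) simp
    have split: "(\<Sum>b\<in>B. d b * u b) = d b0 * u b0 + (\<Sum>b\<in>B'. d b * u b)" for d u :: "'b \<Rightarrow> real"
      unfolding B'_def using b0 psubset.hyps by (subst sum.remove[of B b0]) auto
    \<comment> \<open>Nonnegativity on \<open>K'\<close> extends to \<open>K\<close> up to
      \<epsilon>: adding \<open>\<delta> * c0\<close> gives strict positivity on \<open>K'\<close>,
      and a large multiple of \<open>c\<close> then gives positivity on \<open>K\<close>. That
      multiple costs nothing because \<open>y'\<close> annihilates \<open>c\<close>.\<close>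
    have nonneg': "0 \<le> (\<Sum>b\<in>B'. d b * y' b)"
      if d: "\<And>z. z \<in> K' \<Longrightarrow> 0 \<le> (\<Sum>b\<in>B'. d b * e b z)" for d
    proof (rule field_le_epsilon)
      fix \<epsilon> :: real assume \<epsilon>: "0 < \<epsilon>"
      define Y where "Y = (\<Sum>b\<in>B. c0 b * y' b)"
      have Y: "0 \<le> Y" unfolding Y_def y'_def
        by (rule pos) (use psubset.prems(4) in \<open>auto intro: less_imp_le\<close>)
      define \<delta> where "\<delta> = \<epsilon> / (Y + 1)"
      have \<delta>: "0 < \<delta>" using \<epsilon> Y by (simp add: \<delta>_def)
      define d' where "d' = d(b0 := 0)"
      have d'sum: "(\<Sum>b\<in>B. d' b * u b) = (\<Sum>b\<in>B'. d b * u b)" for u :: "'b \<Rightarrow> real"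
        unfolding split by (auto simp: d'_def B'_def intro!: sum.cong)
      obtain l where l: "0 \<le> l" "\<And>z. z \<in> K \<Longrightarrow>
          0 < (\<Sum>b\<in>B. (d' b + \<delta> * c0 b) * e b z) + l * (\<Sum>b\<in>B. c b * e b z)"
      proof (rule compact_penalty_positive[OF psubset.prems(1) cont cont c])
        fix z assume "z \<in> K" "(\<Sum>b\<in>B. c b * e b z) = 0"
        then have "0 \<le> (\<Sum>b\<in>B. d' b * e b z)" "0 < \<delta> * (\<Sum>b\<in>B. c0 b * e b z)"
          using d[of z] psubset.prems(4)[of z] \<delta> by (auto simp: K'_def d'sum)
        then show "0 < (\<Sum>b\<in>B. (d' b + \<delta> * c0 b) * e b z)"
          by (simp add: distrib_right sum.distrib sum_distrib_left mult.assoc)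
      qed blast+
      have "0 \<le> (\<Sum>b\<in>B. (d' b + \<delta> * c0 b + l * c b) * y' b)"
        unfolding y'_def
      proof (rule pos)
        fix z assume "z \<in> K"
        from l(2)[OF this] show "0 \<le> (\<Sum>b\<in>B. (d' b + \<delta> * c0 b + l * c b) * e b z)"
          by (simp add: distrib_right sum.distrib sum_distrib_left mult.assoc)
      qed
      also have "\<dots> = (\<Sum>b\<in>B'. d b * y' b) + \<delta> * Y + l * (\<Sum>b\<in>B. c b * y' b)"
        by (simp add: distrib_right sum.distrib sum_distrib_left mult.assoc Y_def d'sum)
      also have "(\<Sum>b\<in>B. c b * y' b) = 0" using c0 by (simp add: y'_def)
      also have "\<delta> * Y \<le> \<epsilon>" using \<epsilon> Y by (simp add: \<delta>_def field_simps)
      finally show "0 \<le> (\<Sum>b\<in>B'. d b * y' b) + \<epsilon>" by simp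
    qed
    \<comment> \<open>Subtracting a multiple of the combination with coefficients \<open>c\<close>,
      which vanishes on \<open>K'\<close>, eliminates \<open>b0\<close> without changing values
      there.\<close>
    have pos': "0 < (\<Sum>b\<in>B'. (c0 b - c0 b0 / c b0 * c b) * e b z)" if z: "z \<in> K'" for z
    proof -
      have "(\<Sum>b\<in>B'. (c0 b - c0 b0 / c b0 * c b) * e b z)
          = (\<Sum>b\<in>B. (c0 b - c0 b0 / c b0 * c b) * e b z)"
        unfolding split using b0 by simp
      also have "\<dots> = (\<Sum>b\<in>B. c0 b * e b z) - c0 b0 / c b0 * (\<Sum>b\<in>B. c b * e b z)"
        by (simp add: left_diff_distrib sum_subtractf sum_distrib_left mult.assoc)
      finally show ?thesis using z psubset.prems(4)[of z] by (simp add: K'_def)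
    qed
    have "B' \<subset> B" using b0 by (auto simp: B'_def)
    moreover have "continuous_on K' (e b)" if "b \<in> B'" for b
      using that psubset.prems(2)[of b]
      by (auto simp: B'_def K'_def intro: continuous_on_subset)
    ultimately obtain F s where F: "finite F" "F \<subseteq> K'" "\<forall>z\<in>F. 0 \<le> s z"
      and s: "\<forall>b\<in>B'. y' b = (\<Sum>z\<in>F. s z * e b z)"
      using psubset.IH[of B' K' y', OF _ K' _ nonneg' pos'] by blast
    \<comment> \<open>The coordinate \<open>b0\<close> is recovered from the others:
      \<open>y'\<close> and all evaluations at points of \<open>F\<close> annihilate
      \<open>c\<close>, and \<open>c b0\<close> is nonzero.\<close>
    have rep: "y' b = (\<Sum>z\<in>F. s z * e b z)" if "b \<in> B" for b
    proof (cases "b = b0")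
      case True
      have "c b0 * y' b0 = - (\<Sum>b\<in>B'. c b * y' b)"
        using c0 split[of c y'] by (simp add: y'_def)
      also have "(\<Sum>b\<in>B'. c b * y' b) = (\<Sum>b\<in>B'. \<Sum>z\<in>F. s z * (c b * e b z))"
        using s by (intro sum.cong) (auto simp: sum_distrib_left mult_ac)
      also have "\<dots> = (\<Sum>z\<in>F. s z * (\<Sum>b\<in>B'. c b * e b z))"
        by (subst sum.swap) (simp add: sum_distrib_left)
      also have "\<dots> = (\<Sum>z\<in>F. s z * - (c b0 * e b0 z))"
      proof (intro sum.cong refl)
        fix z assume "z \<in> F"
        then have "(\<Sum>b\<in>B. c b * e b z) = 0" using F(2) by (auto simp: K'_def)
        then have "(\<Sum>b\<in>B'. c b * e b z) = - (c b0 * e b0 z)"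
          using split[of c "\<lambda>b. e b z"] by simp
        then show "s z * (\<Sum>b\<in>B'. c b * e b z) = s z * - (c b0 * e b0 z)" by simp
      qed
      finally have "c b0 * y' b0 = c b0 * (\<Sum>z\<in>F. s z * e b0 z)"
        by (simp add: sum_negf sum_distrib_left mult_ac)
      then show ?thesis using b0 True by simp
    qed (use s that in \<open>auto simp: B'_def\<close>)
    \<comment> \<open>The point \<open>x\<close> may already be an atom in \<open>F\<close>, so the
      weights are added.\<close>
    define s' where "s' = (\<lambda>z. (if z \<in> F then s z else 0) + (if z = x then t else 0))"
    have "y b = (\<Sum>z\<in>insert x F. s' z * e b z)" if "b \<in> B" for b
    proof -
      have "(\<Sum>z\<in>insert x F. s' z * e b z) = (\<Sum>z\<in>insert x F. if z \<in> F then s z * e b z else 0) +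
          (\<Sum>z\<in>insert x F. if z = x then t * e b z else 0)"
        unfolding s'_def sum.distrib[symmetric] by (intro sum.cong) (auto simp: distrib_right)
      also have "(\<Sum>z\<in>insert x F. if z \<in> F then s z * e b z else 0) = (\<Sum>z\<in>F. s z * e b z)"
        using F(1) by (intro sum.mono_neutral_cong_right) auto
      also have "(\<Sum>z\<in>insert x F. if z = x then t * e b z else 0) = t * e b x"
        using F(1) by simp
      finally show ?thesis using rep[OF that] by (simp add: y'_def)
    qed
    moreover have "insert x F \<subseteq> K" using F(2) x by (auto simp: K'_def)
    moreover have "\<forall>z\<in>insert x F. 0 \<le> s' z" using F(3) t by (auto simp: s'_def)
    ultimately show ?thesis
      using F(1) by (intro exI[of _ "insert x F"] exI[of _ s']) auto
  qed
qed


subsection \<open>Evaluation of polynomials\<close>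

lemma xpow_add: "xpow (a + b) = xpow a * xpow b"
  by (simp add: xpow_def mult_single)

lemma xpow_0: "xpow 0 = 1"
  by (simp add: xpow_def)

lemma const_poly_1: "const_poly 1 = 1"
  by (simp add: const_poly_def)

lemma const_poly_add: "const_poly (a + b) = const_poly a + const_poly b"
  by (simp add: const_poly_def single_add)

lemma const_poly_mult: "const_poly (a * b) = const_poly a * const_poly b"
  by (simp add: const_poly_def mult_single)

lemma const_poly_sum: "const_poly (\<Sum>i\<in>I. f i) = (\<Sum>i\<in>I. const_poly (f i))"
  by (induction I rule: infinite_finite_induct) (auto simp: const_poly_add, auto simp:
      const_poly_def)

lemma const_poly_prod: "const_poly (\<Prod>i\<in>I. f i) = (\<Prod>i\<in>I. const_poly (f i))"
  by (induction I rule: infinite_finite_induct) (auto simp: const_poly_mult const_poly_1)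

lemma const_poly_power: "const_poly (a ^ n) = const_poly a ^ n"
  by (induction n) (auto simp: const_poly_mult const_poly_1)

lemma const_poly_of_nat: "const_poly (of_nat n) = of_nat n"
  by (induction n) (auto simp: const_poly_add const_poly_1, auto simp: const_poly_def)

lemma poly_eq_sum_xpow:
  "p = (\<Sum>a\<in>Poly_Mapping.keys p. const_poly (Poly_Mapping.lookup p a) * xpow a)"
  unfolding single_conv_xpow[symmetric] by (rule poly_expand) auto

lemma riesz_xpow: "riesz z (xpow a) = z a"
  by (simp add: riesz_def xpow_def)

lemma riesz_const: "riesz z (const_poly c) = c * z 0"
  using riesz_const_mult[of z c "xpow 0"] by (simp add: riesz_xpow) (simp add: xpow_0)

lemma riesz_one: "riesz z 1 = z 0"
  using riesz_const[of z 1] by (simp add: const_poly_1)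

lemma riesz_uminus: "riesz z (- p) = - riesz z p"
  using riesz_add[of z p "- p"] by simp

lemma riesz_diff: "riesz z (p - q) = riesz z p - riesz z q"
  using riesz_add[of z p "- q"] by (simp add: riesz_uminus)

lemma riesz_scale: "riesz (\<lambda>a. s * z a) p = s * riesz z p"
  by (simp add: riesz_def sum_distrib_left mult_ac)

lemma riesz_mult_xpow:
  "riesz z (p * xpow b) = (\<Sum>a\<in>Poly_Mapping.keys p. Poly_Mapping.lookup p a * z (a + b))"
proof -
  have "p * xpow b = (\<Sum>a\<in>Poly_Mapping.keys p. const_poly (Poly_Mapping.lookup p a) * xpow (a + b))"
    by (subst poly_eq_sum_xpow[of p]) (simp only: sum_distrib_right xpow_add mult.assoc)
  then show ?thesis by (simp only: riesz_sum riesz_const_mult riesz_xpow)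
qed

lemma expo_eval_add: "expo_eval (a + b) x = expo_eval a x * expo_eval b x"
  by (simp add: expo_eval_def lookup_add power_add prod.distrib)

lemma expo_eval_0: "expo_eval 0 x = 1"
  by (simp add: expo_eval_def)

lemma poly_eval_eq_riesz: "poly_eval p x = riesz (\<lambda>a. expo_eval a x) p"
  by (simp add: poly_eval_def riesz_def)

lemma poly_eval_xpow: "poly_eval (xpow a) x = expo_eval a x"
  by (simp add: poly_eval_eq_riesz riesz_xpow)

lemma poly_eval_zero: "poly_eval 0 x = 0"
  by (simp add: poly_eval_def)

lemma poly_eval_one: "poly_eval 1 x = 1"
  by (simp add: poly_eval_eq_riesz riesz_one expo_eval_0)

lemma poly_eval_const: "poly_eval (const_poly c) x = c"
  by (simp add: poly_eval_eq_riesz riesz_const expo_eval_0)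

lemma poly_eval_add: "poly_eval (p + q) x = poly_eval p x + poly_eval q x"
  by (simp add: poly_eval_eq_riesz riesz_add)

lemma poly_eval_diff: "poly_eval (p - q) x = poly_eval p x - poly_eval q x"
  by (simp add: poly_eval_eq_riesz riesz_diff)

lemma poly_eval_sum: "poly_eval (\<Sum>i\<in>I. f i) x = (\<Sum>i\<in>I. poly_eval (f i) x)"
  by (simp add: poly_eval_eq_riesz riesz_sum)

lemma poly_eval_mult: "poly_eval (p * q) x = poly_eval p x * poly_eval q x"
proof -
  have mono: "poly_eval (p * xpow b) x = poly_eval p x * expo_eval b x" for p b
    unfolding poly_eval_eq_riesz riesz_mult_xpow
    by (simp add: expo_eval_add riesz_def sum_distrib_left mult_ac)
  have "p * q = (\<Sum>b\<in>Poly_Mapping.keys q. const_poly (Poly_Mapping.lookup q b) * (p * xpow b))"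
    by (subst poly_eq_sum_xpow[of q]) (simp only: sum_distrib_left mult.left_commute)
  then have "poly_eval (p * q) x
      = (\<Sum>b\<in>Poly_Mapping.keys q. Poly_Mapping.lookup q b * poly_eval (p * xpow b) x)"
    by (simp only: poly_eval_eq_riesz riesz_sum riesz_const_mult)
  then show ?thesis
    by (simp add: mono poly_eval_def[of q] sum_distrib_left mult_ac)
qed

lemma poly_eval_power: "poly_eval (p ^ n) x = poly_eval p x ^ n"
  by (induction n) (auto simp: poly_eval_one poly_eval_mult)

lemma expo_eval_single: "expo_eval (Poly_Mapping.single i n) x = (x $ i) ^ n"
proof -
  have "expo_eval (Poly_Mapping.single i n) x = (\<Prod>j\<in>UNIV. if j = i then (x $ i) ^ n else 1)"
    unfolding expo_eval_def by (intro prod.cong) (auto simp: lookup_single when_def)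
  then show ?thesis by simp
qed

lemma poly_eval_var: "poly_eval (var i) x = x $ i"
  by (simp add: var_def poly_eval_xpow expo_eval_single)

lemmas poly_eval_simps = poly_eval_zero poly_eval_one poly_eval_const poly_eval_add poly_eval_diff
  poly_eval_sum poly_eval_mult poly_eval_power poly_eval_var

lemma continuous_on_expo_eval: "continuous_on S (expo_eval a)"
  unfolding expo_eval_def by (intro continuous_intros)

lemma continuous_on_poly_eval: "continuous_on S (poly_eval p)"
  unfolding poly_eval_def by (intro continuous_intros continuous_on_expo_eval)

lemma var_power: "var i ^ n = xpow (Poly_Mapping.single i n)"
proof (induction n)
  case (Suc n)
  then show ?case
    by (simp add: var_def flip: xpow_add single_add)
qed (simp add: xpow_0)

lemma xpow_eq_prod:
  fixes a :: "'n::finite expo"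
  shows "xpow a = (\<Prod>i\<in>UNIV. var i ^ Poly_Mapping.lookup a i)"
proof -
  have prod: "(\<Prod>i\<in>I. xpow (f i)) = xpow (\<Sum>i\<in>I. f i)" for I and f :: "'n \<Rightarrow> 'n expo"
    by (induction I rule: infinite_finite_induct) (auto simp: xpow_0 xpow_add)
  have "a = (\<Sum>i\<in>UNIV. Poly_Mapping.single i (Poly_Mapping.lookup a i))"
    by (rule poly_expand) auto
  then show ?thesis by (simp add: var_power prod)
qed

lemma expo_deg_single: "expo_deg (Poly_Mapping.single i n) = n"
proof -
  have "expo_deg (Poly_Mapping.single i n) = (\<Sum>j\<in>UNIV. if j = i then n else 0)"
    unfolding expo_deg_def by (intro sum.cong) (auto simp: lookup_single when_def)
  then show ?thesis by simp
qed

lemma polys_on_keys: "p \<in> polys_on A \<Longrightarrow> Poly_Mapping.keys p \<subseteq> A"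
proof -
  have lk: "Poly_Mapping.lookup (c *\<^sub>R q) a
      = c * Poly_Mapping.lookup q a" for c a and q :: "'n rpoly"
  proof -
    have "finite {i. c * Poly_Mapping.lookup q i \<noteq> 0}"
      by (rule finite_subset[OF _ finite_keys[of q]]) (auto simp: in_keys_iff)
    then show ?thesis by (simp add: scaleR_poly_mapping_def)
  qed
  assume "p \<in> polys_on A"
  then show ?thesis
    unfolding polys_on_def
  proof (induction rule: span_induct_alt)
    case (step c q r)
    then show ?case
      by (auto simp: in_keys_iff lookup_add lk xpow_def lookup_single when_def split: if_splits)
  qed simp
qed

subsection \<open>Bernstein coefficients\<close>

text \<open>Choosing a subset of a subset can be done in either order, which moves
  \<open>N choose a\<close> out of the sum; the rest is the binomial theorem. For
  \<open>u + v = 1\<close> this gives the Bernstein coefficients of \<open>u ^ a\<close>.\<close>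

lemma bernstein_sum_choose:
  fixes u v :: "'a::comm_ring_1"
  assumes "a \<le> N"
  shows "(\<Sum>k\<le>N. of_nat ((k choose a) * (N choose k)) * (u ^ k * v ^ (N - k)))
    = of_nat (N choose a) * (u ^ a * (u + v) ^ (N - a))"
proof -
  have "(\<Sum>k\<le>N. of_nat ((k choose a) * (N choose k)) * (u ^ k * v ^ (N - k)))
      = (\<Sum>k\<in>{a..N}. of_nat ((k choose a) * (N choose k)) * (u ^ k * v ^ (N - k)))"
    by (rule sum.mono_neutral_right) (auto simp: not_le binomial_eq_0)
  also have "\<dots> = (\<Sum>j\<le>N - a. of_nat (((j + a) choose a) * (N choose (j + a))) * (u ^ (j + a)
      * v ^ (N - (j + a))))"
    using assms by (intro sum.reindex_bij_witness[of _ "\<lambda>j. j + a" "\<lambda>k. k - a"]) auto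
  also have "\<dots> = (\<Sum>j\<le>N - a. of_nat (N choose a) * (u ^ a * (of_nat ((N - a) choose j) * u ^ j
      * v ^ (N - a - j))))"
  proof (intro sum.cong refl)
    fix j assume "j \<in> {..N - a}"
    then have "((j + a) choose a) * (N choose (j + a)) = (N choose a) * ((N - a) choose j)"
      using assms choose_mult[of a "j + a" N] by (simp add: mult.commute)
    then show "of_nat (((j + a) choose a) * (N choose (j + a))) * (u ^ (j + a) * v ^ (N - (j + a)))
        = of_nat (N choose a) * (u ^ a * (of_nat ((N - a) choose j) * u ^ j * v ^ (N - a - j)))"
      by (simp add: power_add mult_ac add.commute)
  qed
  also have "\<dots> = of_nat (N choose a) * (u ^ a * (u + v) ^ (N - a))"
    by (simp add: binomial_ring sum_distrib_left)
  finally show ?thesis .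
qed

section \<open>Uniform asymptotics of Bernstein coefficients\<close>

text \<open>Boundedness of \<open>g\<close> is built in so that the relation survives
  products.\<close>

definition asymp_eq :: "'a filter \<Rightarrow> ('a \<Rightarrow> real) \<Rightarrow> ('a \<Rightarrow> real) \<Rightarrow> bool" where
  "asymp_eq F f g \<longleftrightarrow> Bfun g F \<and> ((\<lambda>x. f x - g x) \<longlongrightarrow> 0) F"

lemma asymp_eq_const: "asymp_eq F (\<lambda>_. c) (\<lambda>_. c)"
  by (simp add: asymp_eq_def Bfun_const)

lemma Bfun_add_real:
  fixes f g :: "'a \<Rightarrow> real"
  assumes "Bfun f F" "Bfun g F" shows "Bfun (\<lambda>x. f x + g x) F"
proof -
  obtain A B where "eventually (\<lambda>x. norm (f x) \<le> A) F" "eventually (\<lambda>x. norm (g x) \<le> B) F"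
    using assms by (auto simp: Bfun_def)
  then have "eventually (\<lambda>x. norm (f x + g x) \<le> A + B) F"
    by eventually_elim (use norm_triangle_mono in blast)
  then show ?thesis by (rule BfunI)
qed

lemma Bfun_mult_real:
  fixes f g :: "'a \<Rightarrow> real"
  assumes "Bfun f F" "Bfun g F" shows "Bfun (\<lambda>x. f x * g x) F"
proof -
  obtain A B where AB: "A > 0" "B > 0" "eventually (\<lambda>x. norm (f x)
      \<le> A) F" "eventually (\<lambda>x. norm (g x) \<le> B) F"
    using assms by (auto simp: Bfun_def)
  from AB(3,4) have "eventually (\<lambda>x. norm (f x * g x) \<le> A * B) F"
    by eventually_elim (use AB in \<open>auto simp: abs_mult intro!: mult_mono\<close>)
  then show ?thesis by (rule BfunI)
qed

lemma tendsto_0_mult_Bfun: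
  fixes f g :: "'a \<Rightarrow> real"
  assumes "(f \<longlongrightarrow> 0) F" "Bfun g F"
  shows "((\<lambda>x. f x * g x) \<longlongrightarrow> 0) F"
  using bounded_bilinear.Zfun_prod_Bfun[OF bounded_bilinear_mult, of f F g] assms
  by (simp add: tendsto_Zfun_iff)

lemma asymp_eq_add:
  assumes "asymp_eq F f g" "asymp_eq F f' g'"
  shows "asymp_eq F (\<lambda>x. f x + f' x) (\<lambda>x. g x + g' x)"
  using assms tendsto_add_zero[of "\<lambda>x. f x - g x" F "\<lambda>x. f' x - g' x"]
  by (auto simp: asymp_eq_def Bfun_add_real algebra_simps)

lemma asymp_eq_mult:
  assumes fg: "asymp_eq F f g" and fg': "asymp_eq F f' g'"
  shows "asymp_eq F (\<lambda>x. f x * f' x) (\<lambda>x. g x * g' x)"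
proof -
  \<comment> \<open>Expanding \<open>f * f' - g * g'\<close> around \<open>g\<close> and
    \<open>g'\<close> leaves only products of a null function with a null or a bounded one.\<close>
  have "((\<lambda>x. (f x - g x) * (f' x - g' x) + ((f x - g x) * g' x + (f' x - g' x) * g x)) \<longlongrightarrow> 0) F"
    using fg fg' unfolding asymp_eq_def
    by (intro tendsto_add_zero tendsto_0_mult_Bfun tendsto_mult_zero) auto
  then show ?thesis
    using fg fg' by (auto simp: asymp_eq_def Bfun_mult_real algebra_simps)
qed

lemma asymp_eq_sum:
  assumes "\<And>i. i \<in> I \<Longrightarrow> asymp_eq F (f i) (g i)"
  shows "asymp_eq F (\<lambda>x. \<Sum>i\<in>I. f i x) (\<lambda>x. \<Sum>i\<in>I. g i x)"
  using assms
  by (induction I rule: infinite_finite_induct) (auto intro!: asymp_eq_const asymp_eq_add)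

lemma asymp_eq_prod:
  assumes "\<And>i. i \<in> I \<Longrightarrow> asymp_eq F (f i) (g i)"
  shows "asymp_eq F (\<lambda>x. \<Prod>i\<in>I. f i x) (\<lambda>x. \<Prod>i\<in>I. g i x)"
  using assms
  by (induction I rule: infinite_finite_induct) (auto intro!: asymp_eq_const asymp_eq_mult)

text \<open>Convergence along this filter is convergence as \<open>N\<close> tends to infinity,
  uniformly over all multi-indices with entries at most \<open>N\<close>.\<close>

definition grid_filter :: "(nat \<times> ('n \<Rightarrow> nat)) filter" where
  "grid_filter = inf (filtercomap fst sequentially) (principal {(N, \<nu>). \<forall>i. \<nu> i \<le> N})"

lemma eventually_grid_filter:
  "eventually P grid_filter \<longleftrightarrow> (\<exists>N0. \<forall>N\<ge>N0. \<forall>\<nu>. (\<forall>i. \<nu> i \<le> N) \<longrightarrow> P (N, \<nu>))"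
    (is "?L \<longleftrightarrow> ?R")
proof
  assume ?L
  then obtain Q N0 where "\<forall>N\<ge>N0. Q N" and "\<And>x. Q (fst x) \<Longrightarrow> x \<in> {(N, \<nu>). \<forall>i. \<nu> i \<le> N} \<longrightarrow> P x"
    unfolding grid_filter_def eventually_inf_principal eventually_filtercomap
        eventually_sequentially
    by blast
  then show ?R by (intro exI[of _ N0]) auto
next
  assume ?R
  then obtain N0 where "\<forall>N\<ge>N0. \<forall>\<nu>. (\<forall>i. \<nu> i \<le> N) \<longrightarrow> P (N, \<nu>)" by blast
  then show ?L
    unfolding grid_filter_def eventually_inf_principal eventually_filtercomap
    by (intro exI[of _ "\<lambda>N. N0 \<le> N"]) (auto simp: eventually_ge_at_top)
qed

lemma choose_ratio_Suc:
  assumes "k \<le> N" "j < N"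
  shows "real (k choose Suc j) / real (N choose Suc j)
    = real (k choose j) / real (N choose j) * ((real k - real j) / (real N - real j))"
proof -
  have rec: "real (Suc j) * real (m choose Suc j) = (real m - real j) * real (m choose j)" for m
    using gbinomial_mult_1[of "real m" j] by (simp add: binomial_gbinomial left_diff_distrib)
  have "real (k choose Suc j) / real (N choose Suc j)
      = (real (Suc j) * real (k choose Suc j)) / (real (Suc j) * real (N choose Suc j))"
    by simp
  then show ?thesis by (simp only: rec) (simp add: mult_ac)
qed

text \<open>Passing from \<open>j\<close> to \<open>Suc j\<close> multiplies the ratio of binomials
  by \<open>(k - j) / (N - j)\<close>, whose distance to \<open>k / N\<close> is at most
  \<open>j / (N - j)\<close> for all \<open>k \<le> N\<close>.\<close>

lemma asymp_eq_choose_ratio: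
  fixes i :: 'n
  shows "asymp_eq grid_filter (\<lambda>x. real (snd x i choose j) / real (fst x choose j))
    (\<lambda>x. (real (snd x i) / real (fst x)) ^ j)"
proof (induction j)
  case 0
  show ?case by (simp add: asymp_eq_const)
next
  case (Suc j)
  let ?q = "\<lambda>x :: nat \<times> ('n \<Rightarrow> nat). (real (snd x i) - real j) / (real (fst x) - real j)"
  let ?r = "\<lambda>x :: nat \<times> ('n \<Rightarrow> nat). real (snd x i) / real (fst x)"
  have "((\<lambda>N. real j / (real N - real j)) \<longlongrightarrow> 0) sequentially"
    using filterlim_tendsto_add_at_top[OF tendsto_const[of "- real j"] filterlim_real_sequentially]
    by (intro tendsto_divide_0[OF tendsto_const] filterlim_at_top_imp_at_infinity) simp
  moreover have "filterlim fst sequentially (grid_filter :: (nat \<times> ('n \<Rightarrow> nat)) filter)"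
    unfolding grid_filter_def by (rule filterlim_mono[OF filterlim_filtercomap order_refl inf_le1])
  ultimately have lim: "((\<lambda>x. real j / (real (fst x) - real j)) \<longlongrightarrow> 0)
      (grid_filter :: (nat \<times> ('n \<Rightarrow> nat)) filter)"
    by (rule filterlim_compose)
  have bound: "eventually (\<lambda>x. norm (?q x - ?r x) \<le> real j / (real (fst x) - real j)) grid_filter"
    unfolding eventually_grid_filter
  proof (intro exI[of _ "Suc j"] allI impI, unfold fst_conv snd_conv real_norm_def)
    fix N and \<nu> :: "'n \<Rightarrow> nat" assume N: "Suc j \<le> N" and \<nu>: "\<forall>i. \<nu> i \<le> N"
    have pos: "real N - real j > 0" "real N > 0" using N by auto
    have "(real (\<nu> i) - real j) / (real N - real j) - real (\<nu> i) / real N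
      = - (real j / (real N - real j) * ((real N - real (\<nu> i)) / real N))"
      using pos by (simp add: field_simps)
    moreover have "0 \<le> real j / (real N - real j)" using pos by simp
    moreover have "0 \<le> (real N - real (\<nu> i)) / real N" "(real N - real (\<nu> i)) / real N \<le> 1"
      using pos \<nu> by auto
    ultimately show "\<bar>(real (\<nu> i) - real j) / (real N - real j) - real (\<nu> i) / real N\<bar>
      \<le> real j / (real N - real j)"
      by (simp only: abs_minus_cancel abs_of_nonneg mult_nonneg_nonneg mult_left_le)
  qed
  have "((\<lambda>x. ?q x - ?r x) \<longlongrightarrow> 0) grid_filter"
    by (rule Lim_null_comparison[OF bound lim])
  moreover have "eventually (\<lambda>x. norm (?r x) \<le> 1) grid_filter"
    unfolding eventually_grid_filter by (intro exI[of _ 1]) (auto simp: divide_le_eq_1)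
  then have "Bfun ?r grid_filter" by (rule BfunI)
  ultimately have "asymp_eq grid_filter ?q ?r" by (simp only: asymp_eq_def)
  from asymp_eq_mult[OF Suc.IH this]
  have prod: "asymp_eq grid_filter
      (\<lambda>x. real (snd x i choose j) / real (fst x choose j) * ?q x) (\<lambda>x. ?r x ^ Suc j)"
    by (simp only: power_Suc2)
  have "eventually (\<lambda>x. real (snd x i choose j) / real (fst x choose j) * ?q x - ?r x ^ Suc j
      = real (snd x i choose Suc j) / real (fst x choose Suc j) - ?r x ^ Suc j) grid_filter"
    unfolding eventually_grid_filter fst_conv snd_conv
    by (intro exI[of _ "Suc j"] allI impI) (simp only: choose_ratio_Suc Suc_le_eq)
  then show ?case
    using prod unfolding asymp_eq_def by (blast intro: Lim_transform_eventually)
qed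


subsection \<open>Functionals nonnegative on squares\<close>

text \<open>The affine coordinate that maps [-\<rho>, \<rho>] onto [0, 1];
  \<open>box_cocoord\<close> is its complement to 1.\<close>

definition box_coord :: "real \<Rightarrow> 'n \<Rightarrow> 'n rpoly" where
  "box_coord \<rho> i = const_poly (1 / (2 * \<rho>)) * (const_poly \<rho> + var i)"

definition box_cocoord :: "real \<Rightarrow> 'n \<Rightarrow> 'n rpoly" where
  "box_cocoord \<rho> i = const_poly (1 / (2 * \<rho>)) * (const_poly \<rho> - var i)"

lemma box_coord_add_cocoord: "0 < \<rho> \<Longrightarrow> box_coord \<rho> i + box_cocoord \<rho> i = 1"
proof -
  assume "0 < \<rho>"
  have "box_coord \<rho> i + box_cocoord \<rho> i = const_poly (1 / (2 * \<rho>)) * (const_poly \<rho> + const_poly \<rho>)"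
    by (simp add: box_coord_def box_cocoord_def distrib_left[symmetric])
  also have "\<dots> = const_poly (1 / (2 * \<rho>) * (\<rho> + \<rho>))"
    by (simp only: const_poly_mult const_poly_add)
  finally show ?thesis using \<open>0 < \<rho>\<close> by (simp add: const_poly_1)
qed

lemma var_eq_box_coord: "0 < \<rho> \<Longrightarrow> var i = const_poly (2 * \<rho>) * box_coord \<rho> i + const_poly (- \<rho>)"
proof -
  assume "0 < \<rho>"
  have "const_poly (2 * \<rho>) * box_coord \<rho> i
      = const_poly (2 * \<rho> * (1 / (2 * \<rho>))) * (const_poly \<rho> + var i)"
    by (simp only: box_coord_def const_poly_mult mult.assoc)
  also have "2 * \<rho> * (1 / (2 * \<rho>)) = 1" using \<open>0 < \<rho>\<close> by simp
  finally have "const_poly (2 * \<rho>) * box_coord \<rho> i + const_poly (- \<rho>)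
      = const_poly (\<rho> + - \<rho>) + var i"
    by (simp only: const_poly_1 const_poly_add) simp
  then show ?thesis by (simp add: const_poly_def)
qed

text \<open>
  The identity is exact because the Bernstein coefficients of \<open>u\<^sup>j\<close> are
  \<open>(k choose j) / (N choose j)\<close>; these differ from the values \<open>(k / N)\<^sup>j\<close> by a quantity that
  vanishes uniformly in \<open>k\<close>, so the coefficients of a positive polynomial are eventually positive.
\<close>

lemma bernstein_certificate:
  fixes p :: "'n::finite rpoly"
  assumes \<rho>: "0 < \<rho>" and pos: "\<And>x. (\<And>i. \<bar>x $ i\<bar> \<le> \<rho>) \<Longrightarrow> 0 < poly_eval p x"
  obtains N c where "\<And>\<nu>. \<nu> \<in> PiE UNIV (\<lambda>_. {..N}) \<Longrightarrow> 0 \<le> c \<nu>"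
    "p = (\<Sum>\<nu>\<in>PiE UNIV (\<lambda>_. {..N}). const_poly (c \<nu>) *
      (\<Prod>i\<in>UNIV. box_coord \<rho> i ^ \<nu> i * box_cocoord \<rho> i ^ (N - \<nu> i)))"
proof -
  \<comment> \<open>\<open>cf a j\<close> is the coefficient of \<open>u ^ j\<close> in
    \<open>(2 * \<rho> * u - \<rho>) ^ a\<close>. Then \<open>\<beta> N k a\<close> is the
    coefficient of \<open>var i ^ a\<close> at the Bernstein polynomial \<open>B N i k\<close>,
    \<open>C\<close> is the tensor-product analogue for \<open>p\<close>, and \<open>node\<close> is
    the grid point of the box that belongs to an index.\<close>
  define cf where "cf = (\<lambda>a j. real (a choose j) * (2 * \<rho>) ^ j * (- \<rho>) ^ (a - j))"
  define \<beta> where "\<beta> = (\<lambda>N k a. \<Sum>j\<le>a. cf a j * (real (k choose j) / real (N choose j)))"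
  define B where "B = (\<lambda>N (i :: 'n) k. of_nat (N choose k) * (box_coord \<rho> i ^ k
      * box_cocoord \<rho> i ^ (N - k)))"
  define C where "C = (\<lambda>x :: nat \<times> ('n \<Rightarrow> nat). \<Sum>\<alpha>\<in>Poly_Mapping.keys p.
    Poly_Mapping.lookup p \<alpha> * (\<Prod>i\<in>UNIV. \<beta> (fst x) (snd x i) (Poly_Mapping.lookup \<alpha> i)))"
  define node where "node = (\<lambda>x :: nat \<times> ('n \<Rightarrow> nat).
    (\<chi> i. 2 * \<rho> * (real (snd x i) / real (fst x)) + - \<rho>) :: real ^ 'n)"

  have var_pow: "var i ^ a = (\<Sum>k\<le>N. const_poly (\<beta> N k a) * B N i k)" if "a \<le> N" for i a N
  proof -
    have u: "box_coord \<rho> i ^ j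
        = (\<Sum>k\<le>N. const_poly (real (k choose j) / real (N choose j)) * B N i k)"
      if "j \<le> N" for j
    proof -
      have "const_poly (real (N choose j)) * box_coord \<rho> i ^ j
          = (\<Sum>k\<le>N. const_poly (real (k choose j)) * B N i k)"
        using bernstein_sum_choose[OF that, of "box_coord \<rho> i" "box_cocoord \<rho> i"]
        by (simp add: box_coord_add_cocoord[OF \<rho>] const_poly_of_nat B_def mult.assoc)
      then have "const_poly (1 / real (N choose j)) * (const_poly (real (N choose j))
          * box_coord \<rho> i ^ j)
          = (\<Sum>k\<le>N. const_poly (1 / real (N choose j)) * (const_poly (real (k choose j)) * B N i k))"
        by (simp add: sum_distrib_left)
      moreover have "1 / real (N choose j) * real (N choose j) = 1" using that by simp
      ultimately show ?thesis
        by (simp only: mult.assoc[symmetric] const_poly_mult[symmetric] const_poly_1 mult_1)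
          (simp add: const_poly_1)
    qed
    have "var i ^ a = (const_poly (2 * \<rho>) * box_coord \<rho> i + const_poly (- \<rho>)) ^ a"
      using var_eq_box_coord[OF \<rho>, of i] by simp
    also have "\<dots> = (\<Sum>j\<le>a. const_poly (cf a j) * box_coord \<rho> i ^ j)"
      unfolding binomial_ring
      by (intro sum.cong refl)
        (simp add: cf_def const_poly_mult const_poly_power const_poly_of_nat power_mult_distrib
            mult_ac)
    also have "\<dots> = (\<Sum>j\<le>a. \<Sum>k\<le>N. const_poly (cf a j * (real (k choose j) / real (N choose j)))
        * B N i k)"
    proof (intro sum.cong refl)
      fix j assume "j \<in> {..a}"
      then have "j \<le> N" using that by simp
      from u[OF this] show "const_poly (cf a j) * box_coord \<rho> i ^ j =
          (\<Sum>k\<le>N. const_poly (cf a j * (real (k choose j) / real (N choose j))) * B N i k)"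
        by (simp only: sum_distrib_left const_poly_mult mult.assoc)
    qed
    also have "\<dots> = (\<Sum>k\<le>N. const_poly (\<beta> N k a) * B N i k)"
      unfolding \<beta>_def const_poly_sum sum_distrib_right by (rule sum.swap)
    finally show ?thesis .
  qed

  have xpow: "xpow \<alpha> = (\<Sum>\<nu>\<in>PiE UNIV (\<lambda>_. {..N}).
      const_poly (\<Prod>i\<in>UNIV. \<beta> N (\<nu> i) (Poly_Mapping.lookup \<alpha> i)) * (\<Prod>i\<in>UNIV. B N i (\<nu> i)))"
    if "expo_deg \<alpha> \<le> N" for \<alpha> N
  proof -
    have "Poly_Mapping.lookup \<alpha> i \<le> N" for i
    proof -
      have "Poly_Mapping.lookup \<alpha> i \<le> expo_deg \<alpha>"
        unfolding expo_deg_def by (rule member_le_sum) auto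
      then show ?thesis using that by simp
    qed
    then have "xpow \<alpha> = (\<Prod>i\<in>UNIV. \<Sum>k\<le>N. const_poly (\<beta> N k (Poly_Mapping.lookup \<alpha> i)) * B N i k)"
      unfolding xpow_eq_prod by (intro prod.cong refl var_pow)
    also have "\<dots> = (\<Sum>\<nu>\<in>PiE UNIV (\<lambda>_. {..N}).
        \<Prod>i\<in>UNIV. const_poly (\<beta> N (\<nu> i) (Poly_Mapping.lookup \<alpha> i)) * B N i (\<nu> i))"
      by (rule prod_sum_PiE) auto
    finally show ?thesis by (simp only: prod.distrib const_poly_prod)
  qed

  have p: "p = (\<Sum>\<nu>\<in>PiE UNIV (\<lambda>_. {..N}). const_poly (C (N, \<nu>)) * (\<Prod>i\<in>UNIV. B N i (\<nu> i)))"
    if N: "poly_deg p \<le> N" for N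
  proof -
    have "p = (\<Sum>\<alpha>\<in>Poly_Mapping.keys p. const_poly (Poly_Mapping.lookup p \<alpha>) * xpow \<alpha>)"
      by (rule poly_eq_sum_xpow)
    also have "\<dots> = (\<Sum>\<alpha>\<in>Poly_Mapping.keys p. \<Sum>\<nu>\<in>PiE UNIV (\<lambda>_. {..N}).
        const_poly (Poly_Mapping.lookup p \<alpha> * (\<Prod>i\<in>UNIV. \<beta> N (\<nu> i) (Poly_Mapping.lookup \<alpha> i))) *
        (\<Prod>i\<in>UNIV. B N i (\<nu> i)))"
    proof (intro sum.cong refl)
      fix \<alpha> assume "\<alpha> \<in> Poly_Mapping.keys p"
      then have "expo_deg \<alpha> \<le> N" using N expo_deg_le_poly_deg[of \<alpha> p] by simp
      from xpow[OF this] show "const_poly (Poly_Mapping.lookup p \<alpha>) * xpow \<alpha>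
          = (\<Sum>\<nu>\<in>PiE UNIV (\<lambda>_. {..N}).
        const_poly (Poly_Mapping.lookup p \<alpha> * (\<Prod>i\<in>UNIV. \<beta> N (\<nu> i) (Poly_Mapping.lookup \<alpha> i))) *
        (\<Prod>i\<in>UNIV. B N i (\<nu> i)))"
        by (simp only: sum_distrib_left const_poly_mult mult.assoc)
    qed
    also have "\<dots> = (\<Sum>\<nu>\<in>PiE UNIV (\<lambda>_. {..N}). const_poly (C (N, \<nu>)) * (\<Prod>i\<in>UNIV. B N i (\<nu> i)))"
      unfolding C_def fst_conv snd_conv const_poly_sum sum_distrib_right by (rule sum.swap)
    finally show ?thesis .
  qed

  \<comment> \<open>Replacing each binomial ratio in \<open>C\<close> by the corresponding power
    yields the value of \<open>p\<close> at \<open>node\<close>, by the binomial theorem read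
    backwards.\<close>
  have "asymp_eq grid_filter C (\<lambda>x. \<Sum>\<alpha>\<in>Poly_Mapping.keys p. Poly_Mapping.lookup p \<alpha> *
      (\<Prod>i\<in>UNIV. \<Sum>j\<le>Poly_Mapping.lookup \<alpha> i. cf (Poly_Mapping.lookup \<alpha> i) j
          * (real (snd x i) / real (fst x)) ^ j))"
    unfolding C_def \<beta>_def
    by (intro asymp_eq_sum asymp_eq_prod asymp_eq_mult asymp_eq_const asymp_eq_choose_ratio)
  also have "(\<lambda>x. \<Sum>\<alpha>\<in>Poly_Mapping.keys p. Poly_Mapping.lookup p \<alpha> *
      (\<Prod>i\<in>UNIV. \<Sum>j\<le>Poly_Mapping.lookup \<alpha> i. cf (Poly_Mapping.lookup \<alpha> i) j
          * (real (snd x i) / real (fst x)) ^ j))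
      = (\<lambda>x. poly_eval p (node x))"
  proof
    fix x :: "nat \<times> ('n \<Rightarrow> nat)"
    have "(\<Sum>j\<le>a. cf a j * r ^ j) = (2 * \<rho> * r + - \<rho>) ^ a" for a r
      unfolding binomial_ring by (intro sum.cong refl) (simp add: cf_def power_mult_distrib mult_ac)
    then show "(\<Sum>\<alpha>\<in>Poly_Mapping.keys p. Poly_Mapping.lookup p \<alpha> *
      (\<Prod>i\<in>UNIV. \<Sum>j\<le>Poly_Mapping.lookup \<alpha> i. cf (Poly_Mapping.lookup \<alpha> i) j
          * (real (snd x i) / real (fst x)) ^ j))
      = poly_eval p (node x)"
      unfolding poly_eval_def expo_eval_def node_def by simp
  qed
  finally have lim: "((\<lambda>x. C x - poly_eval p (node x)) \<longlongrightarrow> 0) grid_filter"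
    by (simp only: asymp_eq_def)

  define X where "X = {x :: real ^ 'n. \<forall>i. \<bar>x $ i\<bar> \<le> \<rho>}"
  have X_eq: "X = cbox (\<chi> i. - \<rho>) (\<chi> i. \<rho>)"
    by (auto simp: X_def mem_box_cart abs_le_iff minus_le_iff[of "x $ i" \<rho> for x i])
  have "compact X" unfolding X_eq by (rule compact_cbox)
  moreover have "0 \<in> X" using \<rho> by (simp add: X_def)
  ultimately obtain x0 where x0: "x0 \<in> X" "\<And>x. x \<in> X \<Longrightarrow> poly_eval p x0 \<le> poly_eval p x"
    using continuous_attains_inf[of X "poly_eval p"] continuous_on_poly_eval by blast
  have "0 < poly_eval p x0" using pos x0(1) by (simp add: X_def)
  with lim have "eventually (\<lambda>x. dist (C x - poly_eval p (node x)) 0 < poly_eval p x0) grid_filter"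
    by (rule tendstoD)
  then obtain N0 where N0: "\<And>N \<nu>. N \<ge> N0 \<Longrightarrow> (\<forall>i. \<nu> i \<le> N) \<Longrightarrow>
      \<bar>C (N, \<nu>) - poly_eval p (node (N, \<nu>))\<bar> < poly_eval p x0"
    unfolding eventually_grid_filter by (auto simp: dist_norm)
  \<comment> \<open>The bound \<open>poly_deg p\<close> makes the expansion exact; \<open>N0\<close>
    brings each coefficient closer to its node value than the minimum of \<open>p\<close> on the
    box.\<close>
  define N where "N = max 1 (max N0 (poly_deg p))"
  define c where "c = (\<lambda>\<nu>. C (N, \<nu>) * (\<Prod>i\<in>UNIV. real (N choose \<nu> i)))"
  show ?thesis
  proof (rule that[of N c])
    fix \<nu> :: "'n \<Rightarrow> nat" assume "\<nu> \<in> PiE UNIV (\<lambda>_. {..N})"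
    then have \<nu>: "\<nu> i \<le> N" for i by (auto simp: PiE_iff)
    have "node (N, \<nu>) \<in> X"
      unfolding X_def
    proof (intro CollectI allI)
      fix i
      define r where "r = real (\<nu> i) / real N"
      have r: "0 \<le> r" "r \<le> 1" using \<nu>[of i] by (auto simp: r_def N_def)
      have "2 * \<rho> * r \<le> 2 * \<rho>" "0 \<le> 2 * \<rho> * r" using r \<rho> by (auto simp: mult_left_le)
      then have "\<bar>2 * \<rho> * r + - \<rho>\<bar> \<le> \<rho>" by linarith
      then show "\<bar>node (N, \<nu>) $ i\<bar> \<le> \<rho>" by (simp add: node_def r_def)
    qed
    then have "poly_eval p x0 \<le> poly_eval p (node (N, \<nu>))" by (rule x0(2))
    moreover have "\<bar>C (N, \<nu>) - poly_eval p (node (N, \<nu>))\<bar> < poly_eval p x0"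
      using \<nu> by (intro N0) (auto simp: N_def)
    ultimately have "0 \<le> C (N, \<nu>)" by linarith
    then show "0 \<le> c \<nu>" by (simp add: c_def prod_nonneg)
  next
    have "const_poly (C (N, \<nu>)) * (\<Prod>i\<in>UNIV. B N i (\<nu> i)) = const_poly (c \<nu>) *
      (\<Prod>i\<in>UNIV. box_coord \<rho> i ^ \<nu> i * box_cocoord \<rho> i ^ (N - \<nu> i))" for \<nu>
      by (simp only: c_def B_def prod.distrib const_poly_mult const_poly_prod const_poly_of_nat
          mult.assoc)
    then show "p = (\<Sum>\<nu>\<in>PiE UNIV (\<lambda>_. {..N}). const_poly (c \<nu>) *
      (\<Prod>i\<in>UNIV. box_coord \<rho> i ^ \<nu> i * box_cocoord \<rho> i ^ (N - \<nu> i)))"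
      using p[of N] by (simp add: N_def)
  qed
qed

section \<open>Log-convexity and nonnegativity on the box\<close>

text \<open>Log-convexity makes successive ratios nondecreasing. If the first ratio \<open>s\<close>
  exceeded \<open>r\<close>, then \<open>a j\<close> would be at least \<open>a 0 * s ^ j\<close>
  and outgrow every multiple of \<open>r ^ j\<close>.\<close>

lemma log_convex_growth:
  fixes a :: "nat \<Rightarrow> real"
  assumes nonneg: "\<And>j. 0 \<le> a j" and conv: "\<And>j. (a (Suc j))\<^sup>2 \<le> a j * a (Suc (Suc j))"
    and growth: "\<And>j. a j \<le> D * r ^ j" and r: "0 < r"
  shows "a 1 \<le> r * a 0"
proof (rule ccontr)
  assume "\<not> a 1 \<le> r * a 0"
  then have gt: "r * a 0 < a 1" by simp
  have a0: "0 < a 0"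
  proof (rule ccontr)
    assume "\<not> 0 < a 0"
    then have "a 0 = 0" using nonneg[of 0] by simp
    then show False using conv[of 0] gt by simp
  qed
  define s where "s = a 1 / a 0"
  have s: "r < s" using gt a0 by (simp add: s_def pos_less_divide_eq)
  have step: "0 < a j \<and> s * a j \<le> a (Suc j)" for j
  proof (induction j)
    case 0
    then show ?case using a0 by (simp add: s_def)
  next
    case (Suc j)
    have "0 < s * a j" using Suc s r by simp
    then have pos: "0 < a (Suc j)" using Suc by linarith
    have "a j * (s * a (Suc j)) = a (Suc j) * (s * a j)" by simp
    also have "\<dots> \<le> a (Suc j) * a (Suc j)" using Suc pos by (intro mult_left_mono) auto
    also have "\<dots> \<le> a j * a (Suc (Suc j))" using conv[of j] by (simp add: power2_eq_square)
    finally show ?case using Suc pos by simp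
  qed
  have geom: "a 0 * s ^ j \<le> a j" for j
  proof (induction j)
    case (Suc j)
    have "a 0 * s ^ Suc j = s * (a 0 * s ^ j)" by simp
    also have "\<dots> \<le> s * a j" using Suc s r by (intro mult_left_mono) auto
    also have "\<dots> \<le> a (Suc j)" using step by blast
    finally show ?case .
  qed simp
  have "1 < s / r" using s r by simp
  then obtain n where n: "D / a 0 < (s / r) ^ n" using real_arch_pow by blast
  have "a 0 * s ^ n \<le> D * r ^ n" using geom growth order_trans by blast
  moreover have "D * r ^ n < a 0 * s ^ n"
    using n a0 r by (simp add: power_divide field_simps)
  ultimately show False by simp
qed

text \<open>Positive semidefiniteness of the untruncated localizing matrix of
  \<open>m\<close>.\<close>

definition pos_weight :: "('n expo \<Rightarrow> real) \<Rightarrow> 'n rpoly \<Rightarrow> bool" where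
  "pos_weight w m \<longleftrightarrow> (\<forall>f. 0 \<le> riesz w (m * f\<^sup>2))"

lemma pos_weight_cauchy_schwarz:
  assumes "pos_weight w m"
  shows "(riesz w (m * (f * g)))\<^sup>2 \<le> riesz w (m * f\<^sup>2) * riesz w (m * g\<^sup>2)"
proof -
  define A B C where "A = riesz w (m * f\<^sup>2)" and "B = riesz w (m * (f * g))" and "C
      = riesz w (m * g\<^sup>2)"
  have quad: "0 \<le> s * s * A + 2 * (s * t * B) + t * t * C" for s t
  proof -
    have "m * (const_poly s * f + const_poly t * g)\<^sup>2 = const_poly (s * s) * (m * f\<^sup>2) +
        (const_poly (s * t) * (m * (f * g)) + const_poly (s * t) * (m * (f * g))) + const_poly (t
            * t) * (m * g\<^sup>2)"
      by (simp add: const_poly_mult power2_eq_square algebra_simps)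
    then have "riesz w (m * (const_poly s * f + const_poly t * g)\<^sup>2)
        = s * s * A + (s * t * B + s * t * B) + t * t * C"
      by (simp only: riesz_add riesz_const_mult A_def B_def C_def)
    then show ?thesis using assms unfolding pos_weight_def by (metis mult_2)
  qed
  have A: "0 \<le> A" using assms by (simp add: pos_weight_def A_def)
  have "B\<^sup>2 \<le> A * C"
  proof (cases "A = 0")
    case True
    have "B = 0"
    proof (rule ccontr)
      assume "B \<noteq> 0"
      \<comment> \<open>For \<open>A = 0\<close> the form is affine in \<open>s\<close> once
        \<open>t = 1\<close>; this value of \<open>s\<close> makes it equal to -1.\<close>
      then have "2 * (- (C + 1) / (2 * B) * 1 * B) = - (C + 1)" by simp
      then show False using quad[of "- (C + 1) / (2 * B)" 1] True by simp
    qed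
    then show ?thesis using True by simp
  next
    case False
    \<comment> \<open>The direction \<open>s = - B\<close>, \<open>t = A\<close> turns the form into
      \<open>A\<close> times the required difference.\<close>
    have "0 \<le> A * (A * C - B\<^sup>2)" using quad[of "- B" A]
        by (simp add: power2_eq_square algebra_simps)
    then show ?thesis using False A by (simp add: zero_le_mult_iff)
  qed
  then show ?thesis by (simp add: A_def B_def C_def)
qed

text \<open>The values on \<open>m * (var i ^ j * f)\<^sup>2\<close> are log-convex in
  \<open>j\<close> by Cauchy-Schwarz and bounded by a multiple of
  \<open>(\<rho>\<^sup>2) ^ j\<close>, so \<open>log_convex_growth\<close> compares the first
  two.\<close>

lemma pos_weight_box_square:
  fixes w :: "'n::finite expo \<Rightarrow> real"
  assumes growth: "\<And>a. \<bar>w a\<bar> \<le> C * \<rho> ^ expo_deg a" and \<rho>: "0 < \<rho>" and m: "pos_weight w m"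
  shows "riesz w (m * (var i * f)\<^sup>2) \<le> \<rho>\<^sup>2 * riesz w (m * f\<^sup>2)"
proof -
  define a where "a = (\<lambda>j. riesz w (m * (var i ^ j * f)\<^sup>2))"
  define q where "q = m * f\<^sup>2"
  define D where "D = (\<Sum>b\<in>Poly_Mapping.keys q. \<bar>Poly_Mapping.lookup q b\<bar> * (C * \<rho> ^ expo_deg b))"
  have "a 1 \<le> \<rho>\<^sup>2 * a 0"
  proof (rule log_convex_growth)
    show "0 \<le> a j" for j using m by (simp add: a_def pos_weight_def)
    show "(a (Suc j))\<^sup>2 \<le> a j * a (Suc (Suc j))" for j
    proof -
      \<comment> \<open>The square at \<open>Suc j\<close> is also the mixed product of the factors
        at \<open>j\<close> and \<open>j + 2\<close>, to which Cauchy-Schwarz applies.\<close>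
      have "m * (var i ^ Suc j * f)\<^sup>2 = m * ((var i ^ j * f) * (var i ^ Suc (Suc j) * f))"
        by (simp add: power2_eq_square mult_ac)
      then show ?thesis unfolding a_def by (simp only: pos_weight_cauchy_schwarz[OF m])
    qed
    show "a j \<le> D * (\<rho>\<^sup>2) ^ j" for j
    proof -
      have "m * (var i ^ j * f)\<^sup>2 = q * var i ^ (2 * j)"
        by (simp add: q_def power_mult_distrib mult_ac flip: power_mult)
      then have "a j = (\<Sum>b\<in>Poly_Mapping.keys q. Poly_Mapping.lookup q b * w (b
          + Poly_Mapping.single i (2 * j)))"
        by (simp only: a_def var_power riesz_mult_xpow)
      also have "\<dots> \<le> (\<Sum>b\<in>Poly_Mapping.keys q. \<bar>Poly_Mapping.lookup q b\<bar> * (C * \<rho> ^ expo_deg b)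
          * (\<rho>\<^sup>2) ^ j)"
      proof (rule sum_mono)
        fix b
        have "\<bar>w (b + Poly_Mapping.single i (2 * j))\<bar> \<le> C * \<rho> ^ expo_deg b * (\<rho>\<^sup>2) ^ j"
          using growth[of "b + Poly_Mapping.single i (2 * j)"]
          by (simp add: expo_deg_add expo_deg_single power_add power_mult)
        then have "\<bar>Poly_Mapping.lookup q b\<bar> * \<bar>w (b + Poly_Mapping.single i (2 * j))\<bar>
            \<le> \<bar>Poly_Mapping.lookup q b\<bar> * (C * \<rho> ^ expo_deg b * (\<rho>\<^sup>2) ^ j)"
          by (intro mult_left_mono) auto
        moreover have "Poly_Mapping.lookup q b * w (b + Poly_Mapping.single i (2 * j))
            \<le> \<bar>Poly_Mapping.lookup q b\<bar> * \<bar>w (b + Poly_Mapping.single i (2 * j))\<bar>"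
          by (simp flip: abs_mult)
        ultimately show "Poly_Mapping.lookup q b * w (b + Poly_Mapping.single i (2 * j))
            \<le> \<bar>Poly_Mapping.lookup q b\<bar> * (C * \<rho> ^ expo_deg b) * (\<rho>\<^sup>2) ^ j"
          by (simp add: mult.assoc)
      qed
      finally show ?thesis by (simp only: D_def sum_distrib_right)
    qed
    show "0 < \<rho>\<^sup>2" using \<rho> by simp
  qed
  then show ?thesis by (simp add: a_def)
qed

text \<open>For both choices of \<open>l\<close> one has \<open>2 * \<rho> * l = l\<^sup>2 +
  (\<rho>\<^sup>2 - (var i)\<^sup>2)\<close>: the first summand is a square, and the second is
  controlled by \<open>pos_weight_box_square\<close>.\<close>

lemma pos_weight_box_factor:
  fixes w :: "'n::finite expo \<Rightarrow> real"
  assumes growth: "\<And>a. \<bar>w a\<bar> \<le> C * \<rho> ^ expo_deg a" and \<rho>: "0 < \<rho>" and m: "pos_weight w m"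
    and l: "l = const_poly \<rho> + var i \<or> l = const_poly \<rho> - var i"
  shows "pos_weight w (m * (const_poly (1 / (2 * \<rho>)) * l))"
  unfolding pos_weight_def
proof
  fix f
  have two: "(const_poly 2 :: 'n rpoly) = 2"
    using const_poly_of_nat[of 2] by simp
  have "const_poly (\<rho> + \<rho>) * (m * l * f\<^sup>2)
      = m * (l * f)\<^sup>2 + (const_poly (\<rho> * \<rho>) * (m * f\<^sup>2) - m * (var i * f)\<^sup>2)"
    using l by (elim disjE; hypsubst)
      (simp_all add: power2_eq_square algebra_simps const_poly_mult const_poly_add two)
  then have "(\<rho> + \<rho>) * riesz w (m * l * f\<^sup>2)
      = riesz w (m * (l * f)\<^sup>2) + (\<rho>\<^sup>2 * riesz w (m * f\<^sup>2) - riesz w (m * (var i * f)\<^sup>2))"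
    by (simp only: riesz_add riesz_diff riesz_const_mult[symmetric] power2_eq_square[of \<rho>])
  moreover have "0 \<le> riesz w (m * (l * f)\<^sup>2)" using m by (simp add: pos_weight_def)
  moreover note pos_weight_box_square[OF growth \<rho> m, of i f]
  ultimately have "0 \<le> (\<rho> + \<rho>) * riesz w (m * l * f\<^sup>2)" by linarith
  then have "0 \<le> riesz w (m * l * f\<^sup>2)" using \<rho> by (simp add: zero_le_mult_iff)
  moreover have "m * (const_poly (1 / (2 * \<rho>)) * l) * f\<^sup>2
      = const_poly (1 / (2 * \<rho>)) * (m * l * f\<^sup>2)"
    by (simp add: mult_ac)
  ultimately show "0 \<le> riesz w (m * (const_poly (1 / (2 * \<rho>)) * l) * f\<^sup>2)"
    using \<rho> by (simp only: riesz_const_mult) simp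
qed

text \<open>The Bernstein certificate has nonnegative coefficients, and each of its products of box
  coordinates is a positive weight, built from the weight 1 one factor at a time.\<close>

lemma riesz_nonneg_of_pos_on_box:
  fixes w :: "'n::finite expo \<Rightarrow> real"
  assumes growth: "\<And>a. \<bar>w a\<bar> \<le> C * \<rho> ^ expo_deg a" and \<rho>: "0 < \<rho>" and w: "pos_weight w 1"
    and pos: "\<And>x. (\<And>i. \<bar>x $ i\<bar> \<le> \<rho>) \<Longrightarrow> 0 < poly_eval p x"
  shows "0 \<le> riesz w p"
proof -
  have coord: "pos_weight w (m * box_coord \<rho> i ^ k)" if "pos_weight w m" for m i k
  proof (induction k)
    case (Suc k)
    then show ?case
      using pos_weight_box_factor[OF growth \<rho>, of "m * box_coord \<rho> i ^ k" "const_poly \<rho> + var i" i]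
      by (simp add: box_coord_def mult_ac)
  qed (use that in simp)
  have cocoord: "pos_weight w (m * box_cocoord \<rho> i ^ k)" if "pos_weight w m" for m i k
  proof (induction k)
    case (Suc k)
    then show ?case
      using pos_weight_box_factor[OF growth \<rho>, of "m * box_cocoord \<rho> i ^ k" "const_poly \<rho>
          - var i" i]
      by (simp add: box_cocoord_def mult_ac)
  qed (use that in simp)
  have prod: "pos_weight w (\<Prod>i\<in>I. box_coord \<rho> i ^ \<nu> i * box_cocoord \<rho> i ^ \<mu> i)" for I \<nu> \<mu>
  proof (induction I rule: infinite_finite_induct)
    case (insert i I)
    from cocoord[OF coord[OF insert.IH, of i "\<nu> i"], of i "\<mu> i"] insert.hyps
    show ?case by (simp add: mult_ac)
  qed (use w in auto)
  obtain N c where c: "\<And>\<nu>. \<nu> \<in> PiE UNIV (\<lambda>_. {..N}) \<Longrightarrow> 0 \<le> c \<nu>"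
    and p: "p = (\<Sum>\<nu>\<in>PiE UNIV (\<lambda>_. {..N}). const_poly (c \<nu>) *
      (\<Prod>i\<in>UNIV. box_coord \<rho> i ^ \<nu> i * box_cocoord \<rho> i ^ (N - \<nu> i)))"
    using bernstein_certificate[OF \<rho> pos] by blast
  have "0 \<le> riesz w (\<Prod>i\<in>UNIV. box_coord \<rho> i ^ \<nu> i * box_cocoord \<rho> i ^ (N - \<nu> i))" for \<nu>
  proof -
    have "pos_weight w (\<Prod>i\<in>UNIV. box_coord \<rho> i ^ \<nu> i * box_cocoord \<rho> i ^ (N - \<nu> i))"
      by (rule prod)
    then have "0 \<le> riesz w ((\<Prod>i\<in>UNIV. box_coord \<rho> i ^ \<nu> i * box_cocoord \<rho> i ^ (N - \<nu> i)) * 1\<^sup>2)"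
      unfolding pos_weight_def by blast
    then show ?thesis by simp
  qed
  then show ?thesis
    using c by (subst p) (auto simp: riesz_sum riesz_const_mult intro!: sum_nonneg)
qed


subsection \<open>Functionals nonnegative on the quadratic module\<close>

text \<open>For \<open>0 \<le> t\<close>, Bernoulli gives \<open>n * t \<le> (1 + t) ^ n\<close>,
  and \<open>(1 + t) * (1 - t) \<le> 1\<close>. For negative \<open>t\<close> the damping factor is
  at least 1.\<close>

lemma damped_penalty_bound:
  fixes t :: real
  assumes "t \<le> 1" "0 < n"
  shows "t * (1 - t) ^ n \<le> 1 / real n - max 0 (- t)"
proof (cases "0 \<le> t")
  case True
  have "real n * (t * (1 - t) ^ n) \<le> (1 + real n * t) * (1 - t) ^ n"
    using True assms by (simp add: distrib_right mult.assoc)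
  also have "\<dots> \<le> (1 + t) ^ n * (1 - t) ^ n"
    using True assms Bernoulli_inequality[of t n] by (intro mult_right_mono) auto
  also have "\<dots> = (1 - t * t) ^ n"
    by (simp add: power_mult_distrib[symmetric] algebra_simps)
  also have "\<dots> \<le> 1"
    using True assms by (intro power_le_one) (auto simp: mult_le_one)
  finally show ?thesis using True assms by (simp add: pos_le_divide_eq mult.commute)
next
  case False
  have "1 \<le> (1 - t) ^ n" using False by (intro one_le_power) simp
  then have "t * (1 - t) ^ n \<le> t * 1" using False by (intro mult_left_mono_neg) auto
  moreover have "0 \<le> 1 / real n" by simp
  ultimately show ?thesis using False by linarith
qed

text \<open>
  For \<open>k\<close> large, \<open>t (1 - t)\<^sup>2\<^sup>k\<close> is negligible for \<open>0 \<le> t \<le> 1\<close> and at most \<open>t\<close> for \<open>t < 0\<close>, so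
  subtracting a multiple of it penalises the violation of \<open>g \<ge> 0\<close> only.
\<close>

lemma riesz_nonneg_of_pos_on_feasible_set:
  fixes w :: "'n::finite expo \<Rightarrow> real"
  assumes growth: "\<And>a. \<bar>w a\<bar> \<le> C * \<rho> ^ expo_deg a" and \<rho>: "0 < \<rho>"
    and sq: "pos_weight w 1" and g: "\<And>q. q \<in> set g \<Longrightarrow> pos_weight w q"
    and h: "\<And>q f. q \<in> set h \<Longrightarrow> riesz w (q * f) = 0"
    and pos: "\<And>x. x \<in> feasible_set h g \<Longrightarrow> 0 < poly_eval p x"
  shows "0 \<le> riesz w p"
proof -
  define X where "X = {x :: real ^ 'n. \<forall>i. \<bar>x $ i\<bar> \<le> \<rho>}"
  have X_eq: "X = cbox (\<chi> i. - \<rho>) (\<chi> i. \<rho>)"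
    by (auto simp: X_def mem_box_cart abs_le_iff minus_le_iff[of "x $ i" \<rho> for x i])
  have X: "compact X" unfolding X_eq by (rule compact_cbox)
  have X0: "0 \<in> X" using \<rho> by (simp add: X_def)
  have "continuous_on X (\<lambda>x. \<Sum>q\<in>set g. \<bar>poly_eval q x\<bar>)"
    by (intro continuous_intros continuous_on_poly_eval)
  then obtain xm where xm: "\<And>x. x \<in> X \<Longrightarrow> (\<Sum>q\<in>set g. \<bar>poly_eval q x\<bar>) \<le> (\<Sum>q\<in>set g. \<bar>poly_eval q xm\<bar>)"
    using continuous_attains_sup[OF X] X0 by blast
  \<comment> \<open>Dividing by \<open>G\<close> brings every constraint polynomial below 1 on the
    box, as \<open>damped_penalty_bound\<close> requires.\<close>
  define G where "G = 1 + (\<Sum>q\<in>set g. \<bar>poly_eval q xm\<bar>)"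
  have G: "0 < G" by (simp add: G_def add_pos_nonneg sum_nonneg)
  have le_G: "poly_eval q x / G \<le> 1" if "q \<in> set g" "x \<in> X" for q x
  proof -
    have "\<bar>poly_eval q x\<bar> \<le> (\<Sum>q\<in>set g. \<bar>poly_eval q x\<bar>)"
      using that(1) by (intro member_le_sum) auto
    then have "poly_eval q x \<le> G" using xm[OF that(2)] by (simp add: G_def)
    then show ?thesis using G by simp
  qed
  \<comment> \<open>A continuous but not polynomial penalty that vanishes only at feasible points;
    \<open>P\<close> below imitates its first sum by damped polynomials.\<close>
  define V where "V = (\<lambda>x. (\<Sum>q\<in>set g. max 0 (- (poly_eval q x / G)))
      + (\<Sum>q\<in>set h. (poly_eval q x)\<^sup>2))"
  have V_cont: "continuous_on X V"
    unfolding V_def using G by (intro continuous_intros continuous_on_poly_eval) auto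
  have V_nonneg: "0 \<le> V x" for x
    unfolding V_def by (intro add_nonneg_nonneg sum_nonneg) auto
  have feas: "x \<in> feasible_set h g" if "V x = 0" for x
  proof -
    have "(\<Sum>q\<in>set g. max 0 (- (poly_eval q x / G))) = 0" "(\<Sum>q\<in>set h. (poly_eval q x)\<^sup>2) = 0"
      using that by (simp_all add: V_def add_nonneg_eq_0_iff sum_nonneg)
    then have "\<forall>q\<in>set g. max 0 (- (poly_eval q x / G)) = 0" "\<forall>q\<in>set h. poly_eval q x = 0"
      by (simp_all add: sum_nonneg_eq_0_iff)
    moreover have "0 \<le> poly_eval q x" if "q \<in> set g" for q
    proof -
      have "max 0 (- (poly_eval q x / G)) = 0" using calculation(1) that by blast
      then have "0 \<le> poly_eval q x / G" by linarith
      then show ?thesis using G by (simp add: zero_le_divide_iff)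
    qed
    ultimately show ?thesis by (simp add: feasible_set_def)
  qed
  obtain l where l: "0 \<le> l" "\<And>x. x \<in> X \<Longrightarrow> 0 < poly_eval p x + l * V x"
    using compact_penalty_positive[OF X continuous_on_poly_eval V_cont, of p] V_nonneg feas pos
        by blast
  have "continuous_on X (\<lambda>x. poly_eval p x + l * V x)"
    by (intro continuous_intros continuous_on_poly_eval V_cont)
  then obtain x0 where x0: "x0 \<in> X" "\<And>x. x \<in> X \<Longrightarrow> poly_eval p x0 + l * V x0
      \<le> poly_eval p x + l * V x"
    using continuous_attains_inf[OF X] X0 by blast
  define \<epsilon> where "\<epsilon> = poly_eval p x0 + l * V x0"
  have \<epsilon>: "0 < \<epsilon>" using l(2) x0(1) by (simp add: \<epsilon>_def)
  \<comment> \<open>This makes the total error \<open>l * card (set g) / (2 * k)\<close> of the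
    damped penalties smaller than the minimum \<epsilon> of \<open>p + l * V\<close> on the
    box.\<close>
  obtain k where k: "l * card (set g) / \<epsilon> < real k" using reals_Archimedean2 by blast
  moreover have "0 \<le> l * card (set g) / \<epsilon>" using l(1) \<epsilon> by simp
  ultimately have k0: "0 < k" by linarith
  define s where "s = (\<lambda>q :: 'n rpoly. 1 - const_poly (1 / G) * q)"
  \<comment> \<open>A polynomial substitute for \<open>p + l * V\<close>. Under the functional the
    subtracted terms are nonnegative and the terms from \<open>h\<close> vanish, so the value at
    \<open>P\<close> is at most the value at \<open>p\<close>.\<close>
  define P where "P = p - const_poly l * (\<Sum>q\<in>set g. const_poly (1 / G) * (q * (s q ^ k)\<^sup>2))
    + const_poly l * (\<Sum>q\<in>set h. q * q)"
  have "0 \<le> riesz w P"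
  proof (rule riesz_nonneg_of_pos_on_box[OF growth \<rho> sq])
    fix x :: "real ^ 'n" assume "\<And>i. \<bar>x $ i\<bar> \<le> \<rho>"
    then have x: "x \<in> X" by (simp add: X_def)
    define t where "t = (\<lambda>q. poly_eval q x / G)"
    have P_eval: "poly_eval P x = poly_eval p x - l * (\<Sum>q\<in>set g. t q * (1 - t q) ^ (2 * k))
        + l * (\<Sum>q\<in>set h. (poly_eval q x)\<^sup>2)"
      by (simp add: P_def s_def t_def poly_eval_simps power_mult[symmetric] mult.commute[of k 2]
          power2_eq_square[of "poly_eval _ _"])
    have "(\<Sum>q\<in>set g. t q * (1 - t q) ^ (2 * k)) \<le> (\<Sum>q\<in>set g. 1 / real (2 * k) - max 0 (- t q))"
      using le_G x k0 by (intro sum_mono damped_penalty_bound) (auto simp: t_def)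
    also have "\<dots> = card (set g) * (1 / real (2 * k)) - (\<Sum>q\<in>set g. max 0 (- t q))"
      by (simp add: sum_subtractf)
    finally have "l * (\<Sum>q\<in>set g. t q * (1 - t q) ^ (2 * k))
        \<le> l * (card (set g) * (1 / real (2 * k)) - (\<Sum>q\<in>set g. max 0 (- t q)))"
      using l(1) by (rule mult_left_mono)
    then have "poly_eval P x \<ge> poly_eval p x + l * V x - l * card (set g) / real (2 * k)"
      unfolding P_eval V_def t_def by (simp add: algebra_simps)
    moreover have "l * card (set g) / real (2 * k) < \<epsilon>"
    proof -
      have "l * card (set g) < \<epsilon> * real k" using k \<epsilon> by (simp add: pos_divide_less_eq mult.commute)
      also have "\<dots> \<le> \<epsilon> * real (2 * k)" using \<epsilon> by simp
      finally show ?thesis using k0 by (simp add: pos_divide_less_eq)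
    qed
    ultimately show "0 < poly_eval P x" using x0(2)[OF x] by (simp add: \<epsilon>_def)
  qed
  moreover have "riesz w P = riesz w p - l * (\<Sum>q\<in>set g. 1 / G * riesz w (q * (s q ^ k)\<^sup>2))"
    unfolding P_def riesz_add riesz_diff riesz_const_mult riesz_sum using h by simp
  moreover have "0 \<le> l * (\<Sum>q\<in>set g. 1 / G * riesz w (q * (s q ^ k)\<^sup>2))"
    using l(1) g G unfolding pos_weight_def by (intro mult_nonneg_nonneg sum_nonneg) auto
  ultimately show ?thesis by linarith
qed

section \<open>Limits of sequences of feasible points\<close>

text \<open>The threshold for \<open>k\<close> may depend on \<open>f\<close>, which absorbs the
  degree bounds of the truncated relaxations.\<close>

definition asymp_nonneg :: "(nat \<Rightarrow> 'n expo \<Rightarrow> real) \<Rightarrow> 'n rpoly \<Rightarrow> bool" where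
  "asymp_nonneg z q \<longleftrightarrow> (\<forall>f. \<forall>\<^sub>F k in sequentially. 0 \<le> riesz (z k) (q * f\<^sup>2))"

lemma asymp_nonneg_zero: "asymp_nonneg z 0"
  by (simp add: asymp_nonneg_def)

lemma asymp_nonneg_add: "asymp_nonneg z p \<Longrightarrow> asymp_nonneg z q \<Longrightarrow> asymp_nonneg z (p + q)"
  unfolding asymp_nonneg_def
proof
  fix f
  assume "\<forall>f. \<forall>\<^sub>F k in sequentially. 0 \<le> riesz (z k) (p * f\<^sup>2)"
    and "\<forall>f. \<forall>\<^sub>F k in sequentially. 0 \<le> riesz (z k) (q * f\<^sup>2)"
  then have "\<forall>\<^sub>F k in sequentially. 0 \<le> riesz (z k) (p * f\<^sup>2)"
    "\<forall>\<^sub>F k in sequentially. 0 \<le> riesz (z k) (q * f\<^sup>2)" by blast+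
  then show "\<forall>\<^sub>F k in sequentially. 0 \<le> riesz (z k) ((p + q) * f\<^sup>2)"
    by eventually_elim (simp add: distrib_right riesz_add)
qed

lemma asymp_nonneg_sum: "(\<And>i. i \<in> I \<Longrightarrow> asymp_nonneg z (f i)) \<Longrightarrow> asymp_nonneg z (\<Sum>i\<in>I. f i)"
  by (induction I rule: infinite_finite_induct) (auto intro: asymp_nonneg_zero asymp_nonneg_add)

lemma asymp_nonneg_sos_mult:
  assumes "\<sigma> \<in> sos" "asymp_nonneg z q"
  shows "asymp_nonneg z (\<sigma> * q)"
proof -
  obtain m and s :: "nat \<Rightarrow> 'a rpoly" where \<sigma>: "\<sigma> = (\<Sum>i<m. (s i)\<^sup>2)" using assms(1)
      by (auto simp: sos_def)
  have "asymp_nonneg z ((s i)\<^sup>2 * q)" for i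
    unfolding asymp_nonneg_def
  proof
    fix f
    have "\<forall>\<^sub>F k in sequentially. 0 \<le> riesz (z k) (q * (s i * f)\<^sup>2)"
      using assms(2) by (simp only: asymp_nonneg_def)
    then show "\<forall>\<^sub>F k in sequentially. 0 \<le> riesz (z k) ((s i)\<^sup>2 * q * f\<^sup>2)"
      by (simp add: power_mult_distrib mult_ac)
  qed
  then show ?thesis unfolding \<sigma> sum_distrib_right by (intro asymp_nonneg_sum)
qed

lemma asymp_nonneg_ideal_plus_qmodule:
  assumes "asymp_nonneg z 1" "\<And>q. q \<in> set g \<Longrightarrow> asymp_nonneg z q"
    and h: "\<And>q f. q \<in> set h \<Longrightarrow> \<forall>\<^sub>F k in sequentially. riesz (z k) (q * f) = 0"
    and "p \<in> ideal_plus_qmodule h g"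
  shows "asymp_nonneg z p"
proof -
  obtain F \<sigma>\<^sub>0 \<sigma> where p: "p = (\<Sum>i<length h. h ! i * F i) + (\<sigma>\<^sub>0 + (\<Sum>j<length g. \<sigma> j * g ! j))"
    and \<sigma>: "\<sigma>\<^sub>0 \<in> sos" "\<forall>j<length g. \<sigma> j \<in> sos"
    using assms(4) by (auto simp: ideal_plus_qmodule_def poly_ideal_def quadratic_module_def)
  have "asymp_nonneg z (h ! i * F i)" if "i < length h" for i
    unfolding asymp_nonneg_def
  proof
    fix f
    have "\<forall>\<^sub>F k in sequentially. riesz (z k) (h ! i * (F i * f\<^sup>2)) = 0"
      using that by (intro h) auto
    then show "\<forall>\<^sub>F k in sequentially. 0 \<le> riesz (z k) (h ! i * F i * f\<^sup>2)"
      by (auto simp: mult.assoc elim: eventually_mono)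
  qed
  moreover have "asymp_nonneg z \<sigma>\<^sub>0" using asymp_nonneg_sos_mult[OF \<sigma>(1) assms(1)] by simp
  moreover have "asymp_nonneg z (\<sigma> j * g ! j)" if "j < length g" for j
    using that \<sigma>(2) assms(2) by (intro asymp_nonneg_sos_mult) auto
  ultimately show ?thesis
    unfolding p by (intro asymp_nonneg_add asymp_nonneg_sum) auto
qed

lemma expo_decompose:
  fixes b :: "'n::finite expo"
  assumes "expo_deg b = Suc n"
  obtains c i where "b = c + Poly_Mapping.single i 1" "expo_deg c = n"
proof -
  obtain i where i: "Poly_Mapping.lookup b i \<noteq> 0"
    using assms by (force simp: expo_deg_def)
  define c where "c = b - Poly_Mapping.single i 1"
  have b: "b = c + Poly_Mapping.single i 1"
    by (rule poly_mapping_eqI) (use i in \<open>auto simp: c_def lookup_add lookup_minus lookup_single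
        when_def\<close>)
  moreover have "expo_deg c = n"
    using assms unfolding b by (simp add: expo_deg_add expo_deg_single)
  ultimately show ?thesis by (rule that)
qed

text \<open>The archimedean element shows that multiplying a square by
  \<open>(var i)\<^sup>2\<close> raises its value by a factor of at most \<rho>. Iteration bounds
  the values at \<open>(xpow b)\<^sup>2\<close>, and the squares of \<open>1 + xpow a\<close> and
  \<open>1 - xpow a\<close> transfer the bound to all moments.\<close>

lemma asymp_nonneg_moment_bound:
  fixes z :: "nat \<Rightarrow> 'n::finite expo \<Rightarrow> real"
  assumes one: "asymp_nonneg z 1"
    and arch: "asymp_nonneg z (const_poly R - (\<Sum>i\<in>UNIV. (var i)\<^sup>2))"
    and \<rho>: "R \<le> \<rho>" "1 \<le> \<rho>"
  shows "\<forall>\<^sub>F k in sequentially. \<bar>z k a\<bar> \<le> z k 0 * \<rho> ^ expo_deg a"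
proof -
  have sq: "\<forall>\<^sub>F k in sequentially. 0 \<le> riesz (z k) (f\<^sup>2)" for f
    using one by (simp add: asymp_nonneg_def)
  have step: "\<forall>\<^sub>F k in sequentially. riesz (z k) ((var i * f)\<^sup>2) \<le> \<rho> * riesz (z k) (f\<^sup>2)" for i f
  proof -
    have "\<forall>\<^sub>F k in sequentially. \<forall>j. 0 \<le> riesz (z k) ((var j * f)\<^sup>2)"
      by (intro eventually_all_finite sq)
    moreover have "\<forall>\<^sub>F k in sequentially. 0
        \<le> riesz (z k) ((const_poly R - (\<Sum>i\<in>UNIV. (var i)\<^sup>2)) * f\<^sup>2)"
      using arch by (simp only: asymp_nonneg_def)
    ultimately show ?thesis using sq[of f]
    proof eventually_elim
      case (elim k)
      have "(const_poly R - (\<Sum>i\<in>UNIV. (var i)\<^sup>2)) * f\<^sup>2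
          = const_poly R * f\<^sup>2 - (\<Sum>j\<in>UNIV. (var j * f)\<^sup>2)"
        by (simp add: left_diff_distrib sum_distrib_right power_mult_distrib)
      with elim(2) have "(\<Sum>j\<in>UNIV. riesz (z k) ((var j * f)\<^sup>2)) \<le> R * riesz (z k) (f\<^sup>2)"
        by (simp add: riesz_diff riesz_sum riesz_const_mult)
      moreover have "riesz (z k) ((var i * f)\<^sup>2) \<le> (\<Sum>j\<in>UNIV. riesz (z k) ((var j * f)\<^sup>2))"
        using elim(1) by (intro member_le_sum) auto
      moreover have "R * riesz (z k) (f\<^sup>2) \<le> \<rho> * riesz (z k) (f\<^sup>2)"
        using elim(3) \<rho>(1) by (intro mult_right_mono)
      ultimately show ?case by linarith
    qed
  qed
  have even: "\<forall>\<^sub>F k in sequentially. riesz (z k) ((xpow b)\<^sup>2) \<le> z k 0 * \<rho> ^ expo_deg b" for b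
  proof (induction "expo_deg b" arbitrary: b)
    case 0
    then have "Poly_Mapping.lookup b i = 0" for i by (simp add: expo_deg_def)
    then have "b = 0" by (intro poly_mapping_eqI) simp
    then show ?case using 0 by (simp add: xpow_0 riesz_one)
  next
    case (Suc n)
    obtain c i where b: "b = c + Poly_Mapping.single i 1" and c: "expo_deg c = n"
      using expo_decompose[of b n] Suc.hyps(2) by metis
    have xb: "xpow b = var i * xpow c" by (simp add: b xpow_add var_def mult.commute)
    have "\<forall>\<^sub>F k in sequentially. riesz (z k) ((xpow c)\<^sup>2) \<le> z k 0 * \<rho> ^ expo_deg c"
      using Suc.hyps(1)[of c] c by simp
    then show ?case using step[of i "xpow c"]
    proof eventually_elim
      case (elim k)
      have "\<rho> * riesz (z k) ((xpow c)\<^sup>2) \<le> \<rho> * (z k 0 * \<rho> ^ expo_deg c)"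
        using elim(1) \<rho>(2) by (intro mult_left_mono) auto
      with elim(2) show ?case unfolding xb Suc.hyps(2)[symmetric] using c by (simp add: mult_ac)
    qed
  qed
  show ?thesis using sq[of 1] sq[of "1 + xpow a"] sq[of "1 - xpow a"] even[of a]
  proof eventually_elim
    case (elim k)
    have "(1 + xpow a)\<^sup>2 = 1 + (xpow a + xpow a) + (xpow a)\<^sup>2"
      "(1 - xpow a)\<^sup>2 = 1 - (xpow a + xpow a) + (xpow a)\<^sup>2"
      by (simp_all add: power2_eq_square algebra_simps)
    then have "0 \<le> z k 0 + (z k a + z k a) + riesz (z k) ((xpow a)\<^sup>2)"
      "0 \<le> z k 0 - (z k a + z k a) + riesz (z k) ((xpow a)\<^sup>2)"
      using elim(2,3) by (simp_all only: riesz_add riesz_diff riesz_one riesz_xpow)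
    moreover have "z k 0 * 1 \<le> z k 0 * \<rho> ^ expo_deg a"
      using elim(1) \<rho>(2) by (intro mult_left_mono) (auto simp: riesz_one)
    ultimately show ?case using elim(4) by linarith
  qed
qed

lemma tendsto_riesz:
  assumes "\<And>a. ((\<lambda>k. v k a) \<longlongrightarrow> w a) F"
  shows "((\<lambda>k. riesz (v k) p) \<longlongrightarrow> riesz w p) F"
  unfolding riesz_def by (intro tendsto_intros assms)

text \<open>
  The total masses \<open>z\<^sub>k(0)\<close> need not be bounded a priori, so the sequence is divided by
  \<open>max 1 (z\<^sub>k(0))\<close>; in the limit the scaling factor \<open>t\<close> vanishes only if the limit has mass
  at least 1.
\<close>

lemma asymp_nonneg_limit:
  fixes z :: "nat \<Rightarrow> 'n::finite expo \<Rightarrow> real"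
  assumes one: "asymp_nonneg z 1" and g: "\<And>q. q \<in> set g \<Longrightarrow> asymp_nonneg z q"
    and h: "\<And>q f. q \<in> set h \<Longrightarrow> \<forall>\<^sub>F k in sequentially. riesz (z k) (q * f) = 0"
    and arch: "archimedean_polys (ideal_plus_qmodule h g)"
    and y: "\<And>a. a \<in> A \<Longrightarrow> \<forall>\<^sub>F k in sequentially. z k a = y a"
  obtains w t where "0 \<le> t" "1 \<le> w 0 + t" "\<And>a. a \<in> A \<Longrightarrow> w a = t * y a"
    "\<And>p. (\<And>x. x \<in> feasible_set h g \<Longrightarrow> 0 < poly_eval p x) \<Longrightarrow> 0 \<le> riesz w p"
proof -
  obtain R where R: "const_poly R - (\<Sum>i\<in>UNIV. (var i)\<^sup>2) \<in> ideal_plus_qmodule h g"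
    using arch by (auto simp: archimedean_polys_def)
  define \<rho> where "\<rho> = max 1 R"
  have \<rho>: "R \<le> \<rho>" "1 \<le> \<rho>" by (simp_all add: \<rho>_def)
  have bound: "\<forall>\<^sub>F k in sequentially. \<bar>z k a\<bar> \<le> z k 0 * \<rho> ^ expo_deg a" for a
    by (rule asymp_nonneg_moment_bound[OF one asymp_nonneg_ideal_plus_qmodule[OF one g h R] \<rho>])
  define s where "s = (\<lambda>k. 1 / max 1 (z k 0))"
  define v where "v = (\<lambda>k a. s k * z k a)"
  have s: "0 < s k" "s k \<le> 1" for k by (auto simp: s_def)
  have v_bound: "\<forall>\<^sub>F k in sequentially. \<bar>v k a\<bar> \<le> \<rho> ^ expo_deg a" for a
    using bound[of a]
  proof eventually_elim
    case (elim k)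
    have "s k * z k 0 \<le> 1" by (simp add: s_def max_def divide_le_eq_1)
    then have "s k * z k 0 * \<rho> ^ expo_deg a \<le> 1 * \<rho> ^ expo_deg a"
      using \<rho> by (intro mult_right_mono) auto
    then have "s k * (z k 0 * \<rho> ^ expo_deg a) \<le> \<rho> ^ expo_deg a" by (simp add: mult.assoc)
    moreover have "s k * \<bar>z k a\<bar> \<le> s k * (z k 0 * \<rho> ^ expo_deg a)"
      using elim s[of k] by (intro mult_left_mono) auto
    ultimately have "s k * \<bar>z k a\<bar> \<le> \<rho> ^ expo_deg a" by linarith
    then show ?case using s[of k] by (simp add: v_def abs_mult)
  qed
  \<comment> \<open>The bound on \<open>v k a\<close> holds only from a threshold depending on
    \<open>a\<close>. Clamping puts the whole sequence into a compact product and eventually leaves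
    each coordinate unchanged.\<close>
  define c where "c = (\<lambda>k a. max (- (\<rho> ^ expo_deg a)) (min (\<rho> ^ expo_deg a) (v k a)))"
  have cv: "\<forall>\<^sub>F k in sequentially. c k a = v k a" for a
    using v_bound[of a] by eventually_elim (auto simp: c_def)
  \<comment> \<open>The scaling factor is carried as an extra coordinate so that it converges
    together with the moments.\<close>
  define X where "X = {w :: 'n expo \<Rightarrow> real. \<forall>a. \<bar>w a\<bar> \<le> \<rho> ^ expo_deg a} \<times> {0..1 :: real}"
  have "compact X" unfolding X_def by (intro compact_Times compact_bounded_functions) simp
  define u where "u = (\<lambda>k. (c k, s k))"
  have "u k \<in> X" for k
  proof -
    have "\<bar>c k a\<bar> \<le> \<rho> ^ expo_deg a" for a
    proof -
      have "0 \<le> \<rho> ^ expo_deg a" using \<rho> by simp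
      then show ?thesis by (auto simp: c_def abs_le_iff)
    qed
    then show ?thesis using s[of k] by (simp add: u_def X_def less_imp_le)
  qed
  then have "eventually (\<lambda>x. x \<in> X) (filtermap u sequentially)" by (simp add: eventually_filtermap)
  then obtain x where x: "x \<in> X" and cluster: "inf (nhds x) (filtermap u sequentially) \<noteq> bot"
    using \<open>compact X\<close> unfolding compact_filter by (metis filtermap_bot_iff sequentially_bot)
  obtain w t where x_eq: "x = (w, t)" by (cases x)
  \<comment> \<open>This filter takes the place of a convergent subsequence: it refines
    \<open>sequentially\<close>, and \<open>u\<close> tends to the cluster point along it.\<close>
  define H where "H = inf sequentially (filtercomap u (nhds x))"
  have H: "H \<noteq> bot"
  proof
    assume "H = bot"
    then have "eventually (\<lambda>_. False) H" by simp
    then obtain P Q where P: "eventually P sequentially"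
        and Q: "eventually Q (filtercomap u (nhds x))"
      and PQ: "\<And>k. P k \<Longrightarrow> Q k \<Longrightarrow> False"
      unfolding H_def eventually_inf by blast
    from Q obtain Q' where Q': "eventually Q' (nhds x)" "\<And>k. Q' (u k) \<Longrightarrow> Q k"
      unfolding eventually_filtercomap by blast
    have "eventually (\<lambda>y. \<not> Q' y) (filtermap u sequentially)"
      unfolding eventually_filtermap using P by eventually_elim (use PQ Q'(2) in blast)
    then have "eventually (\<lambda>_. False) (inf (nhds x) (filtermap u sequentially))"
      unfolding eventually_inf using Q'(1) by blast
    then show False using cluster by (simp add: trivial_limit_def)
  qed
  have ev: "eventually P H" if "eventually P sequentially" for P
    unfolding H_def using that by (rule filter_leD[OF inf_le1])
  have "filterlim u (nhds x) H"
    unfolding H_def by (rule filterlim_mono[OF filterlim_filtercomap order_refl inf_le2])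
  then have u: "(u \<longlongrightarrow> (w, t)) H" by (simp add: x_eq)
  have t_lim: "(s \<longlongrightarrow> t) H" using tendsto_snd[OF u] by (simp add: u_def)
  have w_lim: "((\<lambda>k. v k a) \<longlongrightarrow> w a) H" for a
  proof -
    have "continuous_on UNIV (\<lambda>f :: 'n expo \<Rightarrow> real. f a)"
        by (rule continuous_on_product_coordinates)
    moreover have "(c \<longlongrightarrow> w) H" using tendsto_fst[OF u] by (simp add: u_def)
    ultimately have "((\<lambda>k. c k a) \<longlongrightarrow> w a) H"
      by (rule continuous_on_tendsto_compose) auto
    then show ?thesis using ev[OF cv[of a]] by (rule Lim_transform_eventually)
  qed
  have L_lim: "((\<lambda>k. s k * riesz (z k) p) \<longlongrightarrow> riesz w p) H" for p
    using tendsto_riesz[of v w H p, OF w_lim] by (simp add: v_def riesz_scale)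
  have weight: "pos_weight w q" if "asymp_nonneg z q" for q
    unfolding pos_weight_def
  proof
    fix f
    have "\<forall>\<^sub>F k in H. 0 \<le> riesz (z k) (q * f\<^sup>2)"
      using that unfolding asymp_nonneg_def by (intro ev) blast
    then have "\<forall>\<^sub>F k in H. 0 \<le> s k * riesz (z k) (q * f\<^sup>2)"
      by eventually_elim (use s in \<open>simp add: less_imp_le\<close>)
    then show "0 \<le> riesz w (q * f\<^sup>2)" by (rule tendsto_lowerbound[OF L_lim _ H])
  qed
  show ?thesis
  proof (rule that[of t w])
    show "0 \<le> t" using x by (simp add: x_eq X_def)
    have "((\<lambda>k. v k 0 + s k) \<longlongrightarrow> w 0 + t) H" by (intro tendsto_add w_lim t_lim)
    \<comment> \<open>A mass of at least 1 is scaled to exactly 1, and a smaller mass leaves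
      \<open>s k\<close> equal to 1.\<close>
    moreover have "\<forall>\<^sub>F k in H. 1 \<le> v k 0 + s k"
      using ev[OF bound[of 0]]
    proof eventually_elim
      case (elim k)
      then have "0 \<le> z k 0" by (simp add: expo_deg_def)
      then show ?case by (simp add: v_def s_def field_simps max_def)
    qed
    ultimately show "1 \<le> w 0 + t" by (rule tendsto_lowerbound[OF _ _ H])
    show "w a = t * y a" if "a \<in> A" for a
    proof -
      have "((\<lambda>k. s k * y a) \<longlongrightarrow> t * y a) H" by (intro tendsto_intros t_lim)
      moreover have "\<forall>\<^sub>F k in H. s k * y a = v k a"
        using ev[OF y[OF that]] by eventually_elim (simp add: v_def)
      ultimately have "((\<lambda>k. v k a) \<longlongrightarrow> t * y a) H" by (rule Lim_transform_eventually)
      then show ?thesis using w_lim H tendsto_unique by blast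
    qed
    fix p assume pos: "\<And>x. x \<in> feasible_set h g \<Longrightarrow> 0 < poly_eval p x"
    show "0 \<le> riesz w p"
    proof (rule riesz_nonneg_of_pos_on_feasible_set)
      show "\<bar>w a\<bar> \<le> 1 * \<rho> ^ expo_deg a" for a using x by (simp add: x_eq X_def)
      show "0 < \<rho>" using \<rho> by simp
      show "pos_weight w 1" using weight one .
      show "pos_weight w q" if "q \<in> set g" for q using weight g[OF that] .
      show "0 < poly_eval p x" if "x \<in> feasible_set h g" for x using pos that .
      show "riesz w (q * f) = 0" if "q \<in> set h" for q f
      proof -
        have "\<forall>\<^sub>F k in H. s k * riesz (z k) (q * f) = 0"
          using ev[OF h[OF that, of f]] by eventually_elim simp
        then have "((\<lambda>k. s k * riesz (z k) (q * f)) \<longlongrightarrow> 0) H" by (rule tendsto_eventually)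
        then show ?thesis using L_lim H tendsto_unique by blast
      qed
    qed
  qed
qed


subsection \<open>Moments and relaxations\<close>

lemma sos_eval_nonneg: "\<sigma> \<in> sos \<Longrightarrow> 0 \<le> poly_eval \<sigma> x"
  by (auto simp: sos_def poly_eval_simps sum_nonneg)

lemma ideal_plus_qmodule_eval_nonneg:
  assumes "p \<in> ideal_plus_qmodule h g" "x \<in> feasible_set h g"
  shows "0 \<le> poly_eval p x"
proof -
  obtain F \<sigma>\<^sub>0 \<sigma> where p: "p = (\<Sum>i<length h. h ! i * F i) + (\<sigma>\<^sub>0 + (\<Sum>j<length g. \<sigma> j * g ! j))"
    and \<sigma>: "\<sigma>\<^sub>0 \<in> sos" "\<forall>j<length g. \<sigma> j \<in> sos"
    using assms(1) by (auto simp: ideal_plus_qmodule_def poly_ideal_def quadratic_module_def)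
  have "(\<Sum>i<length h. poly_eval (h ! i) x * poly_eval (F i) x) = 0"
    using assms(2) by (intro sum.neutral) (auto simp: feasible_set_def)
  moreover have "0 \<le> (\<Sum>j<length g. poly_eval (\<sigma> j) x * poly_eval (g ! j) x)"
    using assms(2) \<sigma>(2)
        by (intro sum_nonneg mult_nonneg_nonneg) (auto simp: feasible_set_def intro:
        sos_eval_nonneg)
  ultimately show ?thesis
    using sos_eval_nonneg[OF \<sigma>(1), of x] by (simp add: p poly_eval_simps)
qed

text \<open>Evaluating the archimedean certificate at a feasible point bounds its norm by
  \<open>sqrt R\<close>.\<close>

lemma compact_feasible_set:
  assumes "archimedean_polys (ideal_plus_qmodule h g)"
  shows "compact (feasible_set h g)"
proof -
  obtain R where R: "const_poly R - (\<Sum>i\<in>UNIV. (var i)\<^sup>2) \<in> ideal_plus_qmodule h g"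
    using assms by (auto simp: archimedean_polys_def)
  have "norm x \<le> sqrt R" if "x \<in> feasible_set h g" for x
    using ideal_plus_qmodule_eval_nonneg[OF R that]
    by (simp add: poly_eval_simps norm_vec_def L2_set_def)
  then have "bounded (feasible_set h g)" by (auto simp: bounded_iff)
  moreover have "feasible_set h g = (\<Inter>i\<in>{..<length h}. {x. poly_eval (h ! i) x = 0}) \<inter>
      (\<Inter>j\<in>{..<length g}. {x. 0 \<le> poly_eval (g ! j) x})"
    by (auto simp: feasible_set_def)
  then have "closed (feasible_set h g)"
    by (simp only:) (intro closed_Int closed_INT ballI closed_Collect_eq closed_Collect_le
        continuous_on_poly_eval continuous_on_const)
  ultimately show ?thesis by (simp add: compact_eq_bounded_closed)
qed

section \<open>From measures to feasible points of the relaxations\<close>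

text \<open>The resulting polynomial stands in for the constant 1, whose exponent may be missing
  from \<open>A\<close>. It controls the mass of a representing measure and, later, that of the
  limit functional.\<close>

lemma full_on_lower_bound:
  assumes "compact K" "full_on K A"
  obtains p \<epsilon> where "Poly_Mapping.keys p \<subseteq> A" "0 < \<epsilon>" "\<And>x. x \<in> K \<Longrightarrow> \<epsilon> \<le> poly_eval p x"
proof -
  obtain p where p: "p \<in> polys_on A" "\<And>x. x \<in> K \<Longrightarrow> 0 < poly_eval p x"
    using assms(2) by (auto simp: full_on_def)
  show ?thesis
  proof (cases "K = {}")
    case True
    then show ?thesis using that[of p 1] polys_on_keys[OF p(1)] by simp
  next
    case False
    then obtain x0 where "x0 \<in> K" "\<And>x. x \<in> K \<Longrightarrow> poly_eval p x0 \<le> poly_eval p x"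
      using continuous_attains_inf[OF assms(1) False continuous_on_poly_eval] by blast
    then show ?thesis using that[of p "poly_eval p x0"] polys_on_keys[OF p(1)] p(2) by blast
  qed
qed

text \<open>Fullness forces finite mass: on \<open>K\<close> the constant 1 is dominated by a
  multiple of an integrable polynomial supported in \<open>A\<close>. Any polynomial is then
  integrable, being bounded on the compact set \<open>K\<close>.\<close>

lemma integrable_poly_eval:
  fixes \<mu> :: "(real ^ 'n::finite) measure"
  assumes sets: "sets \<mu> = sets borel" and K: "compact K" "- K \<in> null_sets \<mu>"
    and A: "\<And>a. a \<in> A \<Longrightarrow> integrable \<mu> (expo_eval a)" and full: "full_on K A"
  shows "integrable \<mu> (poly_eval q)"
proof -
  obtain p \<epsilon> where p: "Poly_Mapping.keys p \<subseteq> A" and \<epsilon>: "0 < \<epsilon>" "\<And>x. x \<in> K \<Longrightarrow> \<epsilon> \<le> poly_eval p x"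
    using full_on_lower_bound[OF K(1) full] by blast
  have meas: "poly_eval q \<in> borel_measurable \<mu>" for q
    using borel_measurable_continuous_onI[OF continuous_on_poly_eval]
    by (simp add: measurable_cong_sets[OF sets refl])
  have AE: "AE x in \<mu>. x \<in> K" using AE_not_in[OF K(2)] by simp
  have "integrable \<mu> (poly_eval p)"
    unfolding poly_eval_def using A p
        by (intro Bochner_Integration.integrable_sum integrable_mult_right) auto
  then have one: "integrable \<mu> (\<lambda>_. 1 :: real)"
  proof (rule Bochner_Integration.integrable_bound[OF integrable_divide_zero[of \<epsilon>]])
    show "AE x in \<mu>. norm (1 :: real) \<le> norm (poly_eval p x / \<epsilon>)"
      using AE
    proof eventually_elim
      case (elim x)
      then show ?case using \<epsilon>(1) \<epsilon>(2)[OF elim] by (simp add: pos_le_divide_eq)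
    qed
  qed simp
  have "bounded (poly_eval q ` K)"
    by (intro compact_imp_bounded compact_continuous_image continuous_on_poly_eval K(1))
  then obtain M where "\<forall>x\<in>K. norm (poly_eval q x) \<le> M" by (auto simp: bounded_iff)
  then have M: "norm (poly_eval q x) \<le> M" if "x \<in> K" for x using that by blast
  show ?thesis
  proof (rule Bochner_Integration.integrable_bound[OF integrable_mult_right[OF one, of M] meas])
    show "AE x in \<mu>. norm (poly_eval q x) \<le> norm (M * 1)"
      using AE by eventually_elim (use M in fastforce)
  qed
qed

text \<open>The moments of a representing measure up to degree \<open>2 * k\<close> form a feasible
  point: its quadratic forms are integrals of a constraint polynomial times a square, and the
  entries for \<open>h\<close> integrate functions that vanish almost everywhere.\<close>

lemma moment_set_subset_relaxation:
  fixes h g :: "'n::finite rpoly list"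
  assumes arch: "archimedean_polys (ideal_plus_qmodule h g)"
    and A: "finite A" and full: "full_on (feasible_set h g) A"
  shows "moment_set A (feasible_set h g) \<subseteq> moment_relaxation A h g k"
proof
  fix y assume "y \<in> moment_set A (feasible_set h g)"
  then obtain \<mu> :: "(real ^ 'n) measure" where y: "y \<in> extensional A"
    and sets: "sets \<mu> = sets borel" and null: "- feasible_set h g \<in> null_sets \<mu>"
    and int: "\<And>a. a \<in> A \<Longrightarrow> integrable \<mu> (expo_eval a)"
    and ya: "\<And>a. a \<in> A \<Longrightarrow> y a = integral\<^sup>L \<mu> (expo_eval a)"
    unfolding moment_set_def by blast
  have integ: "integrable \<mu> (poly_eval q)" for q
    by (rule integrable_poly_eval[OF sets compact_feasible_set[OF arch] null int full])
  have integ_mono: "integrable \<mu> (expo_eval a)" for a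
    using integ[of "xpow a"] by (simp add: poly_eval_xpow[abs_def])
  have AE: "AE x in \<mu>. x \<in> feasible_set h g" using AE_not_in[OF null] by simp
  show "y \<in> moment_relaxation A h g k"
  proof (cases "real (expos_deg A) / 2 \<le> real k")
    case False
    then show ?thesis using y by (simp add: moment_relaxation_def)
  next
    case True
    have A_sub: "A \<subseteq> expos_upto (2 * k)"
    proof
      fix a assume "a \<in> A"
      then have "expo_deg a \<le> expos_deg A" using A by (simp add: expos_deg_def)
      then show "a \<in> expos_upto (2 * k)" using True by (simp add: expos_upto_def)
    qed
    define z where "z = restrict (\<lambda>a. integral\<^sup>L \<mu> (expo_eval a)) (expos_upto (2 * k))"
    have riesz_z: "riesz z q = integral\<^sup>L \<mu> (poly_eval q)"
        if "Poly_Mapping.keys q \<subseteq> expos_upto (2 * k)" for q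
    proof -
      have "riesz z q = (\<Sum>a\<in>Poly_Mapping.keys q. integral\<^sup>L \<mu> (\<lambda>x. Poly_Mapping.lookup q a
          * expo_eval a x))"
        unfolding riesz_def using that by (intro sum.cong) (auto simp: z_def integ_mono)
      also have "\<dots> = integral\<^sup>L \<mu> (poly_eval q)"
        unfolding poly_eval_def[abs_def] using integ_mono
            by (intro Bochner_Integration.integral_sum[symmetric]) auto
      finally show ?thesis .
    qed
    have entry: "localizing_matrix k q z \<beta> \<gamma>
        = integral\<^sup>L \<mu> (\<lambda>x. poly_eval q x * expo_eval \<beta> x * expo_eval \<gamma> x)"
      if \<beta>: "\<beta> \<in> loc_index k q" and \<gamma>: "\<gamma> \<in> loc_index k q" for q \<beta> \<gamma>
    proof -
      have "Poly_Mapping.keys (q * xpow \<beta> * xpow \<gamma>) \<subseteq> expos_upto (2 * k)"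
      proof
        fix a assume "a \<in> Poly_Mapping.keys (q * xpow \<beta> * xpow \<gamma>)"
        then have "a \<in> Poly_Mapping.keys (q * xpow (\<beta> + \<gamma>))" by (simp add: xpow_add mult.assoc)
        then obtain b where "a = b + (\<beta> + \<gamma>)" "b \<in> Poly_Mapping.keys q"
          using keys_mult[of q "xpow (\<beta> + \<gamma>)"] by (auto simp: xpow_def split: if_splits)
        then show "a \<in> expos_upto (2 * k)"
          using \<beta> \<gamma> expo_deg_le_poly_deg[of b q]
              by (simp add: expos_upto_def loc_index_def expo_deg_add)
      qed
      then show ?thesis
        unfolding localizing_matrix_entry[OF \<beta> \<gamma>]
        by (simp add: riesz_z poly_eval_mult poly_eval_xpow flip: mult.assoc cong:
            Bochner_Integration.integral_cong)
    qed
    have entry_int: "integrable \<mu> (\<lambda>x. poly_eval q x * expo_eval \<beta> x * expo_eval \<gamma> x)" for q \<beta> \<gamma>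
      using integ[of "q * xpow \<beta> * xpow \<gamma>"]
          by (simp add: poly_eval_mult[abs_def] poly_eval_xpow[abs_def])
    have "z \<in> Phi_set k g"
      unfolding Phi_set_def psd_on_def
    proof (intro CollectI conjI ballI allI)
      show "z \<in> extensional (expos_upto (2 * k))" by (simp add: z_def)
      fix q assume q: "q \<in> insert 1 (set g)"
      show "localizing_matrix k q z \<beta> \<gamma> = localizing_matrix k q z \<gamma> \<beta>"
        if "\<beta> \<in> loc_index k q" "\<gamma> \<in> loc_index k q" for \<beta> \<gamma>
        using that by (simp add: localizing_matrix_entry mult_ac)
      fix v :: "'n expo \<Rightarrow> real"
      let ?I = "loc_index k q"
      have "(\<Sum>\<beta>\<in>?I. \<Sum>\<gamma>\<in>?I. v \<beta> * localizing_matrix k q z \<beta> \<gamma> * v \<gamma>)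
          = (\<Sum>\<beta>\<in>?I. \<Sum>\<gamma>\<in>?I. integral\<^sup>L \<mu> (\<lambda>x. v \<beta> * (poly_eval q x * expo_eval \<beta> x
              * expo_eval \<gamma> x) * v \<gamma>))"
        using entry_int by (intro sum.cong refl) (simp add: entry)
      also have "\<dots> = integral\<^sup>L \<mu> (\<lambda>x. \<Sum>\<beta>\<in>?I. \<Sum>\<gamma>\<in>?I. v \<beta> * (poly_eval q x * expo_eval \<beta> x
          * expo_eval \<gamma> x) * v \<gamma>)"
        using entry_int by (simp add: Bochner_Integration.integral_sum)
      also have "\<dots> = integral\<^sup>L \<mu> (\<lambda>x. poly_eval q x * (\<Sum>\<beta>\<in>?I. v \<beta> * expo_eval \<beta> x)\<^sup>2)"
        by (simp add: power2_eq_square sum_product sum_distrib_left mult_ac)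
      also have "\<dots> \<ge> 0"
      proof (rule integral_nonneg_AE)
        show "AE x in \<mu>. 0 \<le> poly_eval q x * (\<Sum>\<beta>\<in>?I. v \<beta> * expo_eval \<beta> x)\<^sup>2"
          using AE
        proof eventually_elim
          case (elim x)
          then have "0 \<le> poly_eval q x"
            using q by (auto simp: feasible_set_def poly_eval_one in_set_conv_nth)
          then show ?case by simp
        qed
      qed
      finally show "0 \<le> (\<Sum>\<beta>\<in>?I. \<Sum>\<gamma>\<in>?I. v \<beta> * localizing_matrix k q z \<beta> \<gamma> * v \<gamma>)" .
    qed
    moreover have "z \<in> E_set k h"
      unfolding E_set_def
    proof (intro CollectI conjI ballI)
      show "z \<in> extensional (expos_upto (2 * k))" by (simp add: z_def)
      fix q \<beta> \<gamma> assume q: "q \<in> set h" and \<beta>\<gamma>: "\<beta> \<in> loc_index k q" "\<gamma> \<in> loc_index k q"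
      have "AE x in \<mu>. poly_eval q x * expo_eval \<beta> x * expo_eval \<gamma> x = 0"
        using AE by eventually_elim (use q in \<open>auto simp: feasible_set_def in_set_conv_nth\<close>)
      then show "localizing_matrix k q z \<beta> \<gamma> = 0"
        unfolding entry[OF \<beta>\<gamma>] by (rule integral_eq_zero_AE)
    qed
    moreover have "restrict z A = y"
      using y A_sub by (intro extensionalityI[of _ A]) (auto simp: z_def ya)
    ultimately show ?thesis using True by (auto simp: moment_relaxation_def)
  qed
qed

section \<open>From the relaxations back to measures\<close>

lemma finite_atomic_moment_set:
  assumes F: "finite F" "F \<subseteq> K" "\<forall>x\<in>F. 0 \<le> t x" and K: "closed K"
    and y: "y \<in> extensional A" "\<forall>a\<in>A. y a = (\<Sum>x\<in>F. t x * expo_eval a x)"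
  shows "y \<in> moment_set A K"
proof -
  define \<nu> where "\<nu> = point_measure F (\<lambda>x. ennreal (t x))"
  \<comment> \<open>The point measure lives on the space \<open>F\<close> with its power set; the
    identity pushes it forward to the Borel sets of the whole space.\<close>
  define \<mu> where "\<mu> = distr \<nu> borel (\<lambda>x. x)"
  have meas: "(\<lambda>x. x) \<in> measurable \<nu> borel"
    by (simp add: \<nu>_def)
  have "emeasure \<mu> (- K) = emeasure \<nu> ((\<lambda>x. x) -` (- K) \<inter> space \<nu>)"
    unfolding \<mu>_def using K by (intro emeasure_distr meas) auto
  also have "(\<lambda>x. x) -` (- K) \<inter> space \<nu> = {}"
    using F(2) by (auto simp: \<nu>_def space_point_measure)
  finally have "- K \<in> null_sets \<mu>" using K by (auto simp: null_sets_def \<mu>_def)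
  moreover have "integrable \<mu> (expo_eval a) \<and> y a = integral\<^sup>L \<mu> (expo_eval a)" if "a \<in> A" for a
  proof
    have b: "expo_eval a \<in> borel_measurable borel"
      by (rule borel_measurable_continuous_onI[OF continuous_on_expo_eval])
    show "integrable \<mu> (expo_eval a)"
      unfolding \<mu>_def integrable_distr_eq[OF meas b]
      unfolding \<nu>_def by (rule integrable_point_measure_finite[OF F(1)])
    have "integral\<^sup>L \<mu> (expo_eval a) = integral\<^sup>L \<nu> (expo_eval a)"
      unfolding \<mu>_def by (rule integral_distr[OF meas b])
    also have "\<dots> = (\<Sum>x\<in>F. t x * expo_eval a x)"
      unfolding \<nu>_def using F by (subst lebesgue_integral_point_measure_finite) auto
    finally show "y a = integral\<^sup>L \<mu> (expo_eval a)" using y(2) that by simp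
  qed
  moreover have "sets \<mu> = sets borel" by (simp add: \<mu>_def)
  ultimately show ?thesis
    unfolding moment_set_def using y(1) by blast
qed

lemma Phi_set_riesz_nonneg:
  assumes z: "z \<in> Phi_set k g" and q: "q \<in> insert 1 (set g)" and deg: "poly_deg (q * f\<^sup>2) \<le> 2 * k"
  shows "0 \<le> riesz z (q * f\<^sup>2)"
proof -
  have "is_localizing_matrix k q z (localizing_matrix k q z)"
    unfolding localizing_matrix_def by (rule theI'[OF ex1_localizing_matrix])
  then have "riesz z (q * f\<^sup>2) = (\<Sum>\<beta>\<in>loc_index k q. \<Sum>\<gamma>\<in>loc_index k q.
      Poly_Mapping.lookup f \<beta> * localizing_matrix k q z \<beta> \<gamma> * Poly_Mapping.lookup f \<gamma>)"
    using deg unfolding is_localizing_matrix_def by blast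
  then show ?thesis using z q unfolding Phi_set_def psd_on_def by auto
qed

text \<open>The matrix column of exponent 0 already contains the values at
  \<open>q * xpow b\<close>. The degree of \<open>f\<close> is doubled in the hypothesis because its
  exponents have to index rows of the localizing matrix.\<close>

lemma E_set_riesz_zero:
  assumes z: "z \<in> E_set k h" and q: "q \<in> set h" and deg: "poly_deg q + 2 * poly_deg f \<le> 2 * k"
  shows "riesz z (q * f) = 0"
proof -
  have "q * f = (\<Sum>b\<in>Poly_Mapping.keys f. const_poly (Poly_Mapping.lookup f b) * (q * xpow b
      * xpow 0))"
    by (subst poly_eq_sum_xpow[of f]) (simp only: sum_distrib_left xpow_0 mult_1_right
        mult.left_commute)
  then have "riesz z (q * f)
      = (\<Sum>b\<in>Poly_Mapping.keys f. Poly_Mapping.lookup f b * riesz z (q * xpow b * xpow 0))"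
    by (simp only: riesz_sum riesz_const_mult)
  also have "\<dots> = 0"
  proof (intro sum.neutral ballI)
    fix b assume "b \<in> Poly_Mapping.keys f"
    then have "b \<in> loc_index k q" "0 \<in> loc_index k q"
      using deg expo_deg_le_poly_deg[of b f] by (auto simp: loc_index_def expo_deg_def)
    then have "riesz z (q * xpow b * xpow 0) = 0"
      using z q unfolding E_set_def by (auto simp flip: localizing_matrix_entry)
    then show "Poly_Mapping.lookup f b * riesz z (q * xpow b * xpow 0) = 0" by simp
  qed
  finally show ?thesis .
qed

lemma relaxations_subset_moment_set:
  fixes h g :: "'n::finite rpoly list"
  assumes arch: "archimedean_polys (ideal_plus_qmodule h g)"
    and A: "finite A" and full: "full_on (feasible_set h g) A"
  shows "(\<Inter>k\<in>{1..}. moment_relaxation A h g k) \<subseteq> moment_set A (feasible_set h g)"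
proof
  fix y assume y: "y \<in> (\<Inter>k\<in>{1..}. moment_relaxation A h g k)"
  let ?K = "feasible_set h g"
  have K: "compact ?K" by (rule compact_feasible_set[OF arch])
  \<comment> \<open>From this order on, \<open>k\<close> lies in the range of the intersection and
    the relaxation consists of restrictions of feasible points.\<close>
  define k0 where "k0 = max 1 (expos_deg A)"
  have "\<exists>z. z \<in> Phi_set k g \<and> z \<in> E_set k h \<and> y = restrict z A" if "k0 \<le> k" for k
  proof -
    have "1 \<le> k" "real (expos_deg A) / 2 \<le> real k" using that by (auto simp: k0_def)
    moreover have "y \<in> moment_relaxation A h g k" using y \<open>1 \<le> k\<close> by auto
    ultimately show ?thesis unfolding moment_relaxation_def by auto
  qed
  then obtain z where z: "\<And>k. k0 \<le> k \<Longrightarrow> z k \<in> Phi_set k g \<and> z k \<in> E_set k h \<and> y = restrict (z k) A"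
    by metis
  have "y = restrict (z k0) A" using z by blast
  then have y_ext: "y \<in> extensional A" by simp
  have nonneg: "asymp_nonneg z q" if "q \<in> insert 1 (set g)" for q
    unfolding asymp_nonneg_def
  proof
    fix f
    have "0 \<le> riesz (z k) (q * f\<^sup>2)" if "max k0 (poly_deg (q * f\<^sup>2)) \<le> k" for k
      using that z[of k] \<open>q \<in> insert 1 (set g)\<close> by (intro Phi_set_riesz_nonneg[of _ k g]) auto
    then show "\<forall>\<^sub>F k in sequentially. 0 \<le> riesz (z k) (q * f\<^sup>2)"
      unfolding eventually_sequentially by blast
  qed
  have zero: "\<forall>\<^sub>F k in sequentially. riesz (z k) (q * f) = 0" if "q \<in> set h" for q f
  proof -
    have "riesz (z k) (q * f) = 0" if "max k0 (poly_deg q + 2 * poly_deg f) \<le> k" for k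
      using that z[of k] \<open>q \<in> set h\<close> by (intro E_set_riesz_zero[of _ k h]) auto
    then show ?thesis unfolding eventually_sequentially by blast
  qed
  have eq: "\<forall>\<^sub>F k in sequentially. z k a = y a" if "a \<in> A" for a
  proof -
    have "z k a = y a" if "k0 \<le> k" for k
      using z[OF that] \<open>a \<in> A\<close> by simp
    then show ?thesis unfolding eventually_sequentially by blast
  qed
  obtain w t where t: "0 \<le> t" and mass: "1 \<le> w 0 + t" and wy: "\<And>a. a \<in> A \<Longrightarrow> w a = t * y a"
    and pos: "\<And>p. (\<And>x. x \<in> ?K \<Longrightarrow> 0 < poly_eval p x) \<Longrightarrow> 0 \<le> riesz w p"
    by (rule asymp_nonneg_limit[of z g h A y, OF nonneg nonneg zero arch eq]) auto
  have riesz_w: "riesz w p = t * (\<Sum>a\<in>A. Poly_Mapping.lookup p a * y a)"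
      if "Poly_Mapping.keys p \<subseteq> A" for p
    unfolding riesz_superset[OF A that] sum_distrib_left by (intro sum.cong) (auto simp: wy)
  have eval_A: "poly_eval p x
      = (\<Sum>a\<in>A. Poly_Mapping.lookup p a * expo_eval a x)" if "Poly_Mapping.keys p \<subseteq> A" for p x
    unfolding poly_eval_eq_riesz by (rule riesz_superset[OF A that])
  \<comment> \<open>Nonnegativity is reduced to strict positivity by adding a constant \<delta>
    whose value under \<open>w\<close> is at most \<epsilon>.\<close>
  have pos_le: "0 \<le> riesz w p" if "\<And>x. x \<in> ?K \<Longrightarrow> 0 \<le> poly_eval p x" for p
  proof (rule field_le_epsilon)
    fix \<epsilon> :: real assume \<epsilon>: "0 < \<epsilon>"
    have w0: "0 \<le> w 0" using pos[of 1] by (simp add: poly_eval_one riesz_one)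
    define \<delta> where "\<delta> = \<epsilon> / (w 0 + 1)"
    have "0 < \<delta>" using \<epsilon> w0 by (simp add: \<delta>_def)
    then have "0 \<le> riesz w (p + const_poly \<delta>)"
      using that by (intro pos) (simp add: poly_eval_simps add_nonneg_pos)
    moreover have "\<delta> * w 0 \<le> \<epsilon>" using \<epsilon> w0 by (simp add: \<delta>_def field_simps)
    ultimately show "0 \<le> riesz w p + \<epsilon>" by (simp add: riesz_add riesz_const)
  qed
  obtain p0 \<epsilon> where p0: "Poly_Mapping.keys p0 \<subseteq> A" and \<epsilon>: "0 < \<epsilon>" "\<And>x. x \<in> ?K \<Longrightarrow> \<epsilon> \<le> poly_eval p0 x"
    using full_on_lower_bound[OF K full] by blast
  \<comment> \<open>If \<open>t\<close> were 0, then \<open>w\<close> would vanish on polynomials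
    supported in \<open>A\<close> and still have mass at least 1, against its nonnegativity at
    \<open>p0 - const_poly \<epsilon>\<close>.\<close>
  have t_pos: "0 < t"
  proof (rule ccontr)
    assume "\<not> 0 < t"
    then have t0: "t = 0" using t by simp
    have "0 \<le> riesz w (p0 - const_poly \<epsilon>)"
      using \<epsilon>(2) by (intro pos_le) (simp add: poly_eval_simps)
    then have "\<epsilon> * w 0 \<le> 0" using t0 by (simp add: riesz_diff riesz_const riesz_w[OF p0])
    moreover have "0 < \<epsilon> * w 0" using mass t0 \<epsilon>(1) by simp
    ultimately show False by simp
  qed
  \<comment> \<open>Dividing by the positive \<open>t\<close> carries nonnegativity from
    \<open>w\<close> to \<open>y\<close>, the input of the atomic representation.\<close>
  have dual: "0 \<le> (\<Sum>a\<in>A. c a * y a)" if c: "\<And>x. x \<in> ?K \<Longrightarrow> 0 \<le> (\<Sum>a\<in>A. c a * expo_eval a x)" for c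
  proof -
    define p where "p = (\<Sum>a\<in>A. const_poly (c a) * xpow a)"
    have "poly_eval p x = (\<Sum>a\<in>A. c a * expo_eval a x)" for x
      by (simp add: p_def poly_eval_simps poly_eval_xpow)
    then have "0 \<le> riesz w p" using c by (intro pos_le) simp
    also have "riesz w p = t * (\<Sum>a\<in>A. c a * y a)"
      unfolding p_def riesz_sum riesz_const_mult riesz_xpow sum_distrib_left
      by (intro sum.cong) (auto simp: wy)
    finally show ?thesis using t_pos by (simp add: zero_le_mult_iff)
  qed
  have "0 < (\<Sum>a\<in>A. Poly_Mapping.lookup p0 a * expo_eval a x)" if "x \<in> ?K" for x
    using \<epsilon>(1) \<epsilon>(2)[OF that] by (simp add: eval_A[OF p0])
  then obtain F s where "finite F" "F \<subseteq> ?K" "\<forall>x\<in>F. 0 \<le> s x" "\<forall>a\<in>A. y a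
      = (\<Sum>x\<in>F. s x * expo_eval a x)"
    using nonneg_functional_finite_atomic[of A ?K expo_eval y "Poly_Mapping.lookup p0",
        OF A K continuous_on_expo_eval dual] by blast
  then show "y \<in> moment_set A ?K"
    using finite_atomic_moment_set compact_imp_closed[OF K] y_ext by blast
qed

theorem proposition3p3:
  fixes h g :: "'n::finite rpoly list"
    and A :: "'n expo set"
    and K :: "(real ^ 'n) set"
  assumes K_def: "K = feasible_set h g"
    and K_nonempty: "K \<noteq> {}"
    and archimedean: "archimedean_polys (ideal_plus_qmodule h g)"
    and finite_A: "finite A"
    and full: "full_on K A"
  shows "moment_set A K = (\<Inter>k\<in>{1..}. moment_relaxation A h g k)"
proof
  show "moment_set A K \<subseteq> (\<Inter>k\<in>{1..}. moment_relaxation A h g k)"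
    using moment_set_subset_relaxation[OF archimedean finite_A] full unfolding K_def by blast
  show "(\<Inter>k\<in>{1..}. moment_relaxation A h g k) \<subseteq> moment_set A K"
    using relaxations_subset_moment_set[OF archimedean finite_A] full unfolding K_def by blast
qed

end
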